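(* Let $p$ be a prime number, let $\alpha$ be a real quadratic number (a real number algebraic of degree $2$ over $\mathbb{Q}$), and let $f(X)\in\mathbb{Z}[X]$ be an irreducible polynomial with $f(\alpha)=0$. Let $\beta\in\mathbb{Q}_p$ with $f(\beta)\neq 0$. Then the pair $(\alpha,\beta)$ satisfies $$\inf_{\substack{q,r\in\mathbb{Z}\\ qr\neq 0}} \max\{|q|,|r|\}\,|q\alpha-r|\,|q\beta-r|_p=0.$$ More precisely, $$\liminf_{\max\{|Q|,|R|\}\to+\infty} \max\{|Q|,|R|\}\,\log\max\{|Q|,|R|\}\,|Q\alpha-R|\,|Q\beta-R|_p<+\infty,$$ where the $\liminf$ is taken over pairs of integers $(Q,R)$.
   Context: $\mathbb{Q}_p$ denotes the field of $p$-adic numbers, with the $p$-adic absolute value $|\cdot|_p$ normalized by $|p|_p=1/p$; $|\cdot|$ denotes the usual absolute value on $\mathbb{R}$. *)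

theory Defs
  imports
    "HOL-Algebra.QuotRing"
    "HOL-Computational_Algebra.Computational_Algebra"
    "HOL-Library.Extended_Real"
begin

section \<open>The p-adic absolute value on the rationals\<close>

definition padic_abs :: "nat \<Rightarrow> rat \<Rightarrow> real" where
  "padic_abs p x =
     (if x = 0 then 0
      else real p powi (int (multiplicity (int p) (snd (quotient_of x)))
                        - int (multiplicity (int p) (fst (quotient_of x)))))"

section \<open>The field of p-adic numbers\<close>

text \<open>
  The field \<open>\<rat>\<^sub>p\<close> is the completion of \<open>\<rat>\<close> with respect to the p-adic absolute value: the ring of
  p-adic Cauchy sequences of rationals modulo the ideal of p-adic null sequences.
\<close>

definition padic_Cauchy :: "nat \<Rightarrow> (nat \<Rightarrow> rat) \<Rightarrow> bool" where
  "padic_Cauchy p s \<longleftrightarrow> (\<forall>e>0. \<exists>N. \<forall>m\<ge>N. \<forall>n\<ge>N. padic_abs p (s m - s n) < e)"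

definition padic_Cauchy_ring :: "nat \<Rightarrow> (nat \<Rightarrow> rat) ring" where
  "padic_Cauchy_ring p =
     \<lparr>carrier = {s. padic_Cauchy p s},
      monoid.mult = (\<lambda>s t n. s n * t n), one = (\<lambda>n. 1),
      zero = (\<lambda>n. 0), add = (\<lambda>s t n. s n + t n)\<rparr>"

definition padic_null :: "nat \<Rightarrow> (nat \<Rightarrow> rat) set" where
  "padic_null p = {s. (\<lambda>n. padic_abs p (s n)) \<longlonglongrightarrow> 0}"

definition Qp :: "nat \<Rightarrow> (nat \<Rightarrow> rat) set ring" where
  "Qp p = padic_Cauchy_ring p Quot padic_null p"

text \<open>The limit does not depend on the representative \<open>s\<close>, see \<open>Qp_norm_coset\<close> below.\<close>

definition Qp_norm :: "nat \<Rightarrow> (nat \<Rightarrow> rat) set \<Rightarrow> real" where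
  "Qp_norm p x = (THE l. \<forall>s\<in>x. (\<lambda>n. padic_abs p (s n)) \<longlonglongrightarrow> l)"

definition Qp_eval :: "nat \<Rightarrow> int poly \<Rightarrow> (nat \<Rightarrow> rat) set \<Rightarrow> (nat \<Rightarrow> rat) set" where
  "Qp_eval p f x = (\<Oplus>\<^bsub>Qp p\<^esub>i\<in>{..degree f}. [coeff f i] \<cdot>\<^bsub>Qp p\<^esub> (x [^]\<^bsub>Qp p\<^esub> i))"

section \<open>Quadratic numbers\<close>

definition alg_degree :: "real \<Rightarrow> nat" where
  "alg_degree x =
     (LEAST d. \<exists>g :: rat poly. g \<noteq> 0 \<and> degree g = d \<and> poly (map_poly of_rat g) x = 0)"

definition real_quadratic :: "real \<Rightarrow> bool" where
  "real_quadratic x \<longleftrightarrow> algebraic x \<and> alg_degree x = 2"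

section \<open>Basic properties\<close>

lemma padic_abs_0 [simp]: "padic_abs p 0 = 0"
  by (simp add: padic_abs_def)

lemma padic_abs_1 [simp]: "padic_abs p 1 = 1"
  by (simp add: padic_abs_def)

context
  fixes p :: nat
  assumes p: "prime p"
begin

lemma padic_abs_of_frac:
  assumes "a \<noteq> 0" "b \<noteq> 0"
  shows "padic_abs p (of_int a / of_int b) =
    real p powi (int (multiplicity (int p) b) - int (multiplicity (int p) a))"
proof -
  define x :: rat where "x = of_int a / of_int b"
  obtain c d where cd: "quotient_of x = (c, d)" by fastforce
  have d: "d > 0" and x: "x = of_int c / of_int d"
    using quotient_of_denom_pos[OF cd] quotient_of_div[OF cd] by auto
  have x0: "x \<noteq> 0" using assms by (simp add: x_def)
  with x have c: "c \<noteq> 0" by auto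
  have "(of_int (a * d) :: rat) = of_int (c * b)"
    using x assms d unfolding x_def by (simp add: field_simps)
  hence "a * d = c * b" by (simp only: of_int_eq_iff)
  moreover have "prime_elem (int p)" using p by simp
  ultimately have "multiplicity (int p) a + multiplicity (int p) d =
      multiplicity (int p) c + multiplicity (int p) b"
    using assms c d by (metis prime_elem_multiplicity_mult_distrib less_irrefl)
  thus ?thesis using x0 cd unfolding x_def[symmetric] padic_abs_def
    by (auto intro!: arg_cong[where f = "\<lambda>k. real p powi k"])
qed

lemma padic_abs_prime: "padic_abs p (of_nat p) = 1 / real p"
  using padic_abs_of_frac[of "int p" 1] p prime_gt_0_nat[OF p]
  by (simp add: power_int_minus field_simps)

lemma padic_abs_eq_0_iff [simp]: "padic_abs p x = 0 \<longleftrightarrow> x = 0"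
  using prime_gt_0_nat[OF p] by (simp add: padic_abs_def)

lemma padic_abs_nonneg [simp]: "padic_abs p x \<ge> 0"
  by (simp add: padic_abs_def)

lemma rat_frac_cases:
  obtains a b :: int where "b \<noteq> 0" "x = (of_int a / of_int b :: rat)"
  by (metis Fract_of_int_quotient Rat_cases less_irrefl)

lemma padic_abs_mult: "padic_abs p (x * y) = padic_abs p x * padic_abs p y"
proof (cases "x = 0 \<or> y = 0")
  case False
  obtain a b where x: "b \<noteq> 0" "x = of_int a / of_int b" by (rule rat_frac_cases)
  obtain c d where y: "d \<noteq> 0" "y = of_int c / of_int d" by (rule rat_frac_cases)
  have 0: "a \<noteq> 0" "c \<noteq> 0" using x y False by auto
  have "x * y = of_int (a * c) / of_int (b * d)" by (simp add: x y)
  hence "padic_abs p (x * y) = real p powi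
     (int (multiplicity (int p) (b * d)) - int (multiplicity (int p) (a * c)))"
    using padic_abs_of_frac[of "a * c" "b * d"] 0 x y by simp
  also have "int (multiplicity (int p) (b * d)) - int (multiplicity (int p) (a * c)) =
     (int (multiplicity (int p) b) - int (multiplicity (int p) a)) +
     (int (multiplicity (int p) d) - int (multiplicity (int p) c))"
    using 0 x(1) y(1) p by (simp add: prime_elem_multiplicity_mult_distrib)
  finally show ?thesis
    using padic_abs_of_frac 0 x y prime_gt_0_nat[OF p] by (simp add: power_int_add)
qed auto

lemma padic_abs_minus [simp]: "padic_abs p (- x) = padic_abs p x"
proof -
  have "padic_abs p (- 1) * padic_abs p (- 1) = 1"
    by (simp flip: padic_abs_mult)
  hence "padic_abs p (- 1) = 1"
    by (metis padic_abs_nonneg abs_of_nonneg abs_1 real_sqrt_abs2 real_sqrt_one)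
  thus ?thesis using padic_abs_mult[of "- 1" x] by simp
qed

lemma padic_abs_diff_commute: "padic_abs p (x - y) = padic_abs p (y - x)"
  using padic_abs_minus[of "x - y"] by simp

lemma padic_abs_of_int_over:
  "b \<noteq> 0 \<Longrightarrow> padic_abs p (of_int a / of_int b) = padic_abs p (of_int a) / padic_abs p (of_int b)"
  using padic_abs_mult[of "of_int a / of_int b" "of_int b"] by (simp add: field_simps)

lemma padic_abs_of_int: "a \<noteq> 0 \<Longrightarrow>
    padic_abs p (of_int a) = real p powi (- int (multiplicity (int p) a))"
  using padic_abs_of_frac[of a 1] by simp

lemma padic_abs_add_int:
  "padic_abs p (of_int (a + b)) \<le> max (padic_abs p (of_int a)) (padic_abs p (of_int b))"
proof (cases "a = 0 \<or> b = 0 \<or> a + b = 0")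
  case True
  thus ?thesis by (auto simp: le_max_iff_disj simp flip: of_int_add)
next
  case False
  let ?m = "min (multiplicity (int p) a) (multiplicity (int p) b)"
  have "int p ^ ?m dvd a" "int p ^ ?m dvd b"
    by (auto intro!: multiplicity_dvd')
  hence "int p ^ ?m dvd a + b" by simp
  hence "?m \<le> multiplicity (int p) (a + b)"
    using False p prime_gt_1_nat[OF p] by (intro multiplicity_geI) auto
  hence "real p powi (- int (multiplicity (int p) (a + b))) \<le> real p powi (- int ?m)"
    using prime_gt_1_nat[OF p] by (intro power_int_increasing) auto
  also have "\<dots> \<le> max (padic_abs p (of_int a)) (padic_abs p (of_int b))"
    using False by (auto simp: padic_abs_of_int min_def)
  finally show ?thesis using False padic_abs_of_int[of "a + b"] by simp
qed

lemma padic_abs_ultrametric: "padic_abs p (x + y) \<le> max (padic_abs p x) (padic_abs p y)"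
proof -
  obtain a b where x: "b \<noteq> 0" "x = of_int a / of_int b" by (rule rat_frac_cases)
  obtain c d where y: "d \<noteq> 0" "y = of_int c / of_int d" by (rule rat_frac_cases)
  have eq: "x = of_int (a * d) / of_int (b * d)" "y = of_int (c * b) / of_int (b * d)"
      "x + y = of_int (a * d + c * b) / of_int (b * d)"
    using x y by (auto simp: field_simps)
  have bd: "b * d \<noteq> 0" using x y by simp
  have pos: "padic_abs p (of_int (b * d)) > 0"
    using bd padic_abs_eq_0_iff[of "of_int (b * d)"] padic_abs_nonneg[of "of_int (b * d)"]
    by (metis less_eq_real_def of_int_eq_0_iff)
  have "max (padic_abs p x) (padic_abs p y) =
     max (padic_abs p (of_int (a * d))) (padic_abs p (of_int (c * b))) / padic_abs p (of_int (b * d))"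
    unfolding eq(1,2) padic_abs_of_int_over[OF bd]
    using pos by (auto simp: max_def divide_le_cancel)
  moreover have "padic_abs p (x + y) =
      padic_abs p (of_int (a * d + c * b)) / padic_abs p (of_int (b * d))"
    unfolding eq(3) padic_abs_of_int_over[OF bd] ..
  ultimately show ?thesis
    using padic_abs_add_int[of "a * d" "c * b"] pos by (simp add: divide_right_mono)
qed

lemma padic_abs_triangle: "padic_abs p (x + y) \<le> padic_abs p x + padic_abs p y"
  using padic_abs_ultrametric[of x y] padic_abs_nonneg[of x] padic_abs_nonneg[of y] by linarith

lemma padic_abs_triangle_rev: "\<bar>padic_abs p x - padic_abs p y\<bar> \<le> padic_abs p (x - y)"
  using padic_abs_triangle[of "x - y" y] padic_abs_triangle[of "y - x" x]
    padic_abs_diff_commute[of x y] by simp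

lemma padic_abs_inverse: "padic_abs p (inverse x) = inverse (padic_abs p x)"
proof (cases "x = 0")
  case False
  thus ?thesis using padic_abs_mult[of x "inverse x"] by (simp add: field_simps)
qed auto

lemma padic_Cauchy_convergent:
  assumes "padic_Cauchy p s"
  shows "convergent (\<lambda>n. padic_abs p (s n))"
proof -
  have "Cauchy (\<lambda>n. padic_abs p (s n))"
    using assms padic_abs_triangle_rev unfolding padic_Cauchy_def Cauchy_def dist_real_def
    by (meson order_le_less_trans)
  thus ?thesis by (simp add: Cauchy_convergent)
qed

lemma padic_Cauchy_bounded:
  assumes "padic_Cauchy p s"
  obtains B where "B > 0" "\<And>n. padic_abs p (s n) \<le> B"
  using convergent_imp_Bseq[OF padic_Cauchy_convergent[OF assms]] that
  by (auto simp: Bseq_def)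

lemma padic_Cauchy_const [simp]: "padic_Cauchy p (\<lambda>n. c)"
  by (simp add: padic_Cauchy_def)

lemma padic_Cauchy_add:
  assumes "padic_Cauchy p s" "padic_Cauchy p t"
  shows "padic_Cauchy p (\<lambda>n. s n + t n)"
  unfolding padic_Cauchy_def
proof safe
  fix e :: real assume "e > 0"
  then obtain M N where M: "\<And>m n. m \<ge> M \<Longrightarrow> n \<ge> M \<Longrightarrow> padic_abs p (s m - s n) < e"
    and N: "\<And>m n. m \<ge> N \<Longrightarrow> n \<ge> N \<Longrightarrow> padic_abs p (t m - t n) < e"
    using assms unfolding padic_Cauchy_def by metis
  have "padic_abs p (s m + t m - (s n + t n)) < e" if "m \<ge> max M N" "n \<ge> max M N" for m n
    using padic_abs_ultrametric[of "s m - s n" "t m - t n"] M[of m n] N[of m n] that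
    by (simp add: algebra_simps)
  thus "\<exists>N. \<forall>m\<ge>N. \<forall>n\<ge>N. padic_abs p (s m + t m - (s n + t n)) < e" by blast
qed

lemma padic_Cauchy_mult:
  assumes "padic_Cauchy p s" "padic_Cauchy p t"
  shows "padic_Cauchy p (\<lambda>n. s n * t n)"
  unfolding padic_Cauchy_def
proof safe
  fix e :: real assume e: "e > 0"
  obtain A where A: "A > 0" "\<And>n. padic_abs p (s n) \<le> A"
    using padic_Cauchy_bounded[OF assms(1)] by metis
  obtain B where B: "B > 0" "\<And>n. padic_abs p (t n) \<le> B"
    using padic_Cauchy_bounded[OF assms(2)] by metis
  have "e / B > 0" "e / A > 0" using e A B by auto
  then obtain M N where M: "\<And>m n. m \<ge> M \<Longrightarrow> n \<ge> M \<Longrightarrow> padic_abs p (s m - s n) < e / B"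
    and N: "\<And>m n. m \<ge> N \<Longrightarrow> n \<ge> N \<Longrightarrow> padic_abs p (t m - t n) < e / A"
    using assms unfolding padic_Cauchy_def by metis
  have "padic_abs p (s m * t m - s n * t n) < e" if mn: "m \<ge> max M N" "n \<ge> max M N" for m n
  proof -
    have "padic_abs p (s m - s n) * padic_abs p (t m) \<le> padic_abs p (s m - s n) * B"
      by (intro mult_left_mono B) auto
    also have "\<dots> < e" using M[of m n] mn B by (simp add: field_simps)
    finally have 1: "padic_abs p ((s m - s n) * t m) < e" by (simp add: padic_abs_mult)
    have "padic_abs p (s n) * padic_abs p (t m - t n) \<le> A * padic_abs p (t m - t n)"
      by (intro mult_right_mono A) auto
    also have "\<dots> < e" using N[of m n] mn A by (simp add: field_simps)
    finally have 2: "padic_abs p (s n * (t m - t n)) < e" by (simp add: padic_abs_mult)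
    have "s m * t m - s n * t n = (s m - s n) * t m + s n * (t m - t n)"
      by (simp add: algebra_simps)
    thus ?thesis
      using padic_abs_ultrametric[of "(s m - s n) * t m" "s n * (t m - t n)"] 1 2 by simp
  qed
  thus "\<exists>N. \<forall>m\<ge>N. \<forall>n\<ge>N. padic_abs p (s m * t m - s n * t n) < e" by blast
qed

lemma padic_Cauchy_minus: "padic_Cauchy p s \<Longrightarrow> padic_Cauchy p (\<lambda>n. - s n)"
  using padic_Cauchy_mult[OF padic_Cauchy_const[of "- 1"]] by simp

lemma padic_Cauchy_ring_cring: "cring (padic_Cauchy_ring p)"
proof (rule cringI)
  show "abelian_group (padic_Cauchy_ring p)"
  proof (rule abelian_groupI)
    fix x assume "x \<in> carrier (padic_Cauchy_ring p)"
    thus "\<exists>y\<in>carrier (padic_Cauchy_ring p). y \<oplus>\<^bsub>padic_Cauchy_ring p\<^esub> x = \<zero>\<^bsub>padic_Cauchy_ring p\<^esub>"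
      by (intro bexI[of _ "\<lambda>n. - x n"]) (auto simp: padic_Cauchy_ring_def padic_Cauchy_minus)
  qed (auto simp: padic_Cauchy_ring_def padic_Cauchy_add algebra_simps)
  show "comm_monoid (padic_Cauchy_ring p)"
    by (rule comm_monoidI) (auto simp: padic_Cauchy_ring_def padic_Cauchy_mult algebra_simps)
qed (auto simp: padic_Cauchy_ring_def algebra_simps)

lemma padic_null_Cauchy:
  assumes "s \<in> padic_null p"
  shows "padic_Cauchy p s"
  unfolding padic_Cauchy_def
proof safe
  fix e :: real assume "e > 0"
  then obtain N where N: "\<And>n. n \<ge> N \<Longrightarrow> padic_abs p (s n) < e"
    using assms unfolding padic_null_def by (auto simp: LIMSEQ_def)
  have "padic_abs p (s m - s n) < e" if "m \<ge> N" "n \<ge> N" for m n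
    using padic_abs_ultrametric[of "s m" "- s n"] N[of m] N[of n] that by simp
  thus "\<exists>N. \<forall>m\<ge>N. \<forall>n\<ge>N. padic_abs p (s m - s n) < e" by blast
qed

lemma padic_null_add:
  assumes "s \<in> padic_null p" "t \<in> padic_null p"
  shows "(\<lambda>n. s n + t n) \<in> padic_null p"
proof -
  have "(\<lambda>n. padic_abs p (s n) + padic_abs p (t n)) \<longlonglongrightarrow> 0 + 0"
    using assms by (intro tendsto_add) (auto simp: padic_null_def)
  hence lim: "(\<lambda>n. padic_abs p (s n) + padic_abs p (t n)) \<longlonglongrightarrow> 0" by simp
  have "(\<lambda>n. padic_abs p (s n + t n)) \<longlonglongrightarrow> 0"
    by (rule tendsto_0_le[OF lim, where K = 1]) (auto intro!: always_eventually padic_abs_triangle)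
  thus ?thesis by (simp add: padic_null_def)
qed

lemma padic_null_mult:
  assumes "s \<in> padic_null p" "padic_Cauchy p t"
  shows "(\<lambda>n. t n * s n) \<in> padic_null p"
proof -
  obtain L where "(\<lambda>n. padic_abs p (t n)) \<longlonglongrightarrow> L"
    using padic_Cauchy_convergent[OF assms(2)] by (auto simp: convergent_def)
  moreover have "(\<lambda>n. padic_abs p (s n)) \<longlonglongrightarrow> 0"
    using assms by (simp add: padic_null_def)
  ultimately have "(\<lambda>n. padic_abs p (t n) * padic_abs p (s n)) \<longlonglongrightarrow> L * 0"
    by (rule tendsto_mult)
  thus ?thesis by (simp add: padic_null_def padic_abs_mult)
qed

lemma padic_Cauchy_ring_uminus:
  assumes "s \<in> carrier (padic_Cauchy_ring p)"
  shows "\<ominus>\<^bsub>padic_Cauchy_ring p\<^esub> s = (\<lambda>n. - s n)"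
proof -
  interpret cring "padic_Cauchy_ring p" by (rule padic_Cauchy_ring_cring)
  show ?thesis using assms
    by (intro minus_equality) (auto simp: padic_Cauchy_ring_def padic_Cauchy_minus)
qed

lemma padic_null_ideal: "ideal (padic_null p) (padic_Cauchy_ring p)"
proof -
  interpret cring "padic_Cauchy_ring p" by (rule padic_Cauchy_ring_cring)
  have car: "s \<in> carrier (padic_Cauchy_ring p)" if "s \<in> padic_null p" for s
    using padic_null_Cauchy[OF that] by (simp add: padic_Cauchy_ring_def)
  show ?thesis
  proof (rule idealI)
    show "ring (padic_Cauchy_ring p)" by (rule ring_axioms)
    show "subgroup (padic_null p) (add_monoid (padic_Cauchy_ring p))"
    proof (rule add.subgroupI)
      show "padic_null p \<subseteq> carrier (padic_Cauchy_ring p)" using car by blast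
      have "(\<lambda>n. 0) \<in> padic_null p" by (simp add: padic_null_def)
      thus "padic_null p \<noteq> {}" by blast
      show "\<ominus>\<^bsub>padic_Cauchy_ring p\<^esub> s \<in> padic_null p" if "s \<in> padic_null p" for s
        using that by (simp add: padic_Cauchy_ring_uminus[OF car] padic_null_def)
    qed (auto simp: padic_Cauchy_ring_def padic_null_add)
  qed (use padic_null_mult in \<open>auto simp: padic_Cauchy_ring_def mult.commute\<close>)
qed

lemma padic_null_maximalideal: "maximalideal (padic_null p) (padic_Cauchy_ring p)"
proof -
  interpret cring "padic_Cauchy_ring p" by (rule padic_Cauchy_ring_cring)
  show ?thesis
  proof (rule maximalidealI[OF padic_null_ideal])
    have "(\<lambda>n. 1) \<notin> padic_null p" by (simp add: padic_null_def LIMSEQ_const_iff)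
    thus "carrier (padic_Cauchy_ring p) \<noteq> padic_null p"
      by (auto simp: padic_Cauchy_ring_def)
  next
    fix J assume J: "ideal J (padic_Cauchy_ring p)" "padic_null p \<subseteq> J"
      "J \<subseteq> carrier (padic_Cauchy_ring p)"
    interpret J: ideal J "padic_Cauchy_ring p" by (rule J)
    show "J = padic_null p \<or> J = carrier (padic_Cauchy_ring p)"
    proof (cases "J \<subseteq> padic_null p")
      case False
      then obtain s where s: "s \<in> J" "s \<notin> padic_null p" by blast
      hence sC: "padic_Cauchy p s" using J(3) by (auto simp: padic_Cauchy_ring_def)
      obtain L where L: "(\<lambda>n. padic_abs p (s n)) \<longlonglongrightarrow> L"
        using padic_Cauchy_convergent[OF sC] by (auto simp: convergent_def)
      have "L \<ge> 0" by (rule LIMSEQ_le_const[OF L]) auto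
      moreover have "L \<noteq> 0" using L s(2) by (auto simp: padic_null_def)
      ultimately have L0: "L > 0" by simp
      define d where "d = L / 2"
      have d: "d > 0" using L0 by (simp add: d_def)
      have "\<forall>\<^sub>F n in sequentially. padic_abs p (s n) > d"
        by (rule order_tendstoD(1)[OF L]) (use L0 in \<open>simp add: d_def\<close>)
      then obtain N where N: "\<And>n. n \<ge> N \<Longrightarrow> padic_abs p (s n) > d"
        by (auto simp: eventually_sequentially)
      define t where "t n = inverse (s n)" for n
      have tC: "padic_Cauchy p t" unfolding padic_Cauchy_def
      proof safe
        fix e :: real assume "e > 0"
        hence "e * d * d > 0" using d by simp
        then obtain M where M: "\<And>m n. m \<ge> M \<Longrightarrow> n \<ge> M \<Longrightarrow> padic_abs p (s m - s n) < e * d * d"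
          using sC unfolding padic_Cauchy_def by metis
        have "padic_abs p (t m - t n) < e" if mn: "m \<ge> max M N" "n \<ge> max M N" for m n
        proof -
          have gt: "padic_abs p (s m) > d" "padic_abs p (s n) > d" using N mn by auto
          hence nz: "s m \<noteq> 0" "s n \<noteq> 0" using d by auto
          have "s n - s m = (t m - t n) * (s m * s n)"
            using nz by (simp add: t_def algebra_simps)
          hence "padic_abs p (s n - s m) = padic_abs p ((t m - t n) * (s m * s n))" by simp
          also have "\<dots> = padic_abs p (t m - t n) * (padic_abs p (s m) * padic_abs p (s n))"
            by (simp add: padic_abs_mult)
          also have "\<dots> \<ge> padic_abs p (t m - t n) * (d * d)"
            using gt d by (intro mult_left_mono mult_mono) auto
          finally have "padic_abs p (t m - t n) * (d * d) < e * (d * d)"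
            using M[of n m] mn by (simp add: mult.assoc)
          thus ?thesis using d by simp
        qed
        thus "\<exists>N. \<forall>m\<ge>N. \<forall>n\<ge>N. padic_abs p (t m - t n) < e" by blast
      qed
      have st: "(\<lambda>n. s n * t n) \<in> J"
        using J.I_r_closed[OF s(1), of t] tC by (simp add: padic_Cauchy_ring_def)
      have "\<forall>\<^sub>F n in sequentially. padic_abs p (1 - s n * t n) = 0"
        using N d unfolding eventually_sequentially t_def
        by (metis padic_abs_0 diff_self less_asym right_inverse)
      hence "(\<lambda>n. 1 - s n * t n) \<in> padic_null p"
        by (simp add: padic_null_def tendsto_eventually del: padic_abs_eq_0_iff)
      hence "(\<lambda>n. 1 - s n * t n) \<in> J" using J(2) by blast
      from J.a_closed[OF this st] have "\<one>\<^bsub>padic_Cauchy_ring p\<^esub> \<in> J"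
        by (simp add: padic_Cauchy_ring_def)
      thus ?thesis using J.one_imp_carrier by blast
    qed (use J in auto)
  qed
qed

theorem Qp_field: "field (Qp p)"
  unfolding Qp_def
  by (rule maximalideal.quotient_is_field[OF padic_null_maximalideal padic_Cauchy_ring_cring])

lemma Qp_norm_coset:
  assumes "padic_Cauchy p s"
  shows "(\<lambda>n. padic_abs p (s n)) \<longlonglongrightarrow> Qp_norm p (padic_null p +>\<^bsub>padic_Cauchy_ring p\<^esub> s)"
proof -
  obtain L where L: "(\<lambda>n. padic_abs p (s n)) \<longlonglongrightarrow> L"
    using padic_Cauchy_convergent[OF assms] by (auto simp: convergent_def)
  let ?x = "padic_null p +>\<^bsub>padic_Cauchy_ring p\<^esub> s"
  have all: "(\<lambda>n. padic_abs p (t n)) \<longlonglongrightarrow> L" if "t \<in> ?x" for t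
  proof -
    obtain h where h: "h \<in> padic_null p" and t: "t = (\<lambda>n. h n + s n)"
      using \<open>t \<in> ?x\<close> by (auto simp: a_r_coset_def r_coset_def padic_Cauchy_ring_def)
    have h0: "(\<lambda>n. padic_abs p (h n)) \<longlonglongrightarrow> 0" using h by (simp add: padic_null_def)
    have "\<bar>padic_abs p (t n) - padic_abs p (s n)\<bar> \<le> padic_abs p (h n)" for n
      using padic_abs_triangle_rev[of "t n" "s n"] by (simp add: t)
    hence "(\<lambda>n. padic_abs p (t n) - padic_abs p (s n)) \<longlonglongrightarrow> 0"
      by (intro tendsto_0_le[OF h0, where K = 1]) (auto intro!: always_eventually)
    from tendsto_add[OF this L] show ?thesis by simp
  qed
  have "s \<in> ?x"
    by (auto simp: a_r_coset_def r_coset_def padic_Cauchy_ring_def padic_null_def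
        intro!: exI[of _ "\<lambda>n. 0"])
  hence "Qp_norm p ?x = L" unfolding Qp_norm_def
    using all by (intro the_equality) (auto intro: LIMSEQ_unique)
  thus ?thesis using L by simp
qed

end

end

theory Submission
  imports Defs "HOL-Analysis.Kronecker_Approximation_Theorem"
begin

text \<open>
  Let \<open>f = aX\<^sup>2 + bX + c\<close>, \<open>d = b\<^sup>2 - 4ac\<close> and \<open>\<delta> = 2a\<alpha> + b\<close>, so \<open>\<delta>\<^sup>2 = d\<close>. On pairs \<open>(Q, R)\<close>, multiplication of
  \<open>Q\<alpha> - R\<close> by \<open>\<delta>\<close> is the integer map \<open>J (Q, R) = (-bQ - 2aR, 2cQ + bR)\<close>. Pell's equation gives a unit
  \<open>x + y\<delta>\<close> with \<open>x \<equiv> 1\<close>, \<open>y \<equiv> 0\<close> modulo \<open>p\<^sup>2\<close>; along the orbit \<open>v\<^sub>n = (x + yJ)\<^sup>n v\<^sub>0\<close> the product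
  \<open>max(|Q|, |R|) |Q\<alpha> - R|\<close> stays bounded while \<open>log max(|Q|, |R|)\<close> grows linearly in \<open>n\<close>. It remains to
  make \<open>|Q\<beta> - R|\<^sub>p\<close> of size \<open>O(1/n)\<close> for infinitely many \<open>n\<close>. At \<open>(1, \<beta>)\<close> the form \<open>Q\<beta> - R\<close> changes in the
  direction \<open>J (1, \<beta>)\<close> at the rate \<open>-2f(\<beta>) \<noteq> 0\<close>, so if \<open>v\<^sub>0\<close> is p-adically close to the line through
  \<open>(1, \<beta>)\<close>, a Hensel-type lifting produces for each \<open>k\<close> some \<open>n \<le> 2p\<^sup>k\<close> with \<open>|Q\<^sub>n\<beta> - R\<^sub>n|\<^sub>p = O(p\<^sup>-\<^sup>k)\<close>.
\<close>

section \<open>Pell units\<close>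

text \<open>With \<open>e = k * \<theta> - h\<close> one has h^2 - d k^2 = e^2 - 2 e k \<theta>. A
  Dirichlet approximation satisfies |e| k < 1, which bounds both terms independently of h and
  k.\<close>

lemma approx_set_norm_bound:
  fixes \<theta> :: real
  assumes \<theta>: "\<theta>\<^sup>2 = real_of_int d" and hk: "(h, k) \<in> approx_set \<theta>"
  shows "\<bar>h\<^sup>2 - d * k\<^sup>2\<bar> \<le> \<lceil>2 * \<bar>\<theta>\<bar> + 1\<rceil>"
proof -
  have k: "k > 0" and approx: "\<bar>\<theta> - real_of_int h / real_of_int k\<bar> < 1 / (real_of_int k)\<^sup>2"
    using hk by (auto simp: approx_set_def)
  define e where "e = real_of_int k * \<theta> - real_of_int h"
  have "\<bar>e\<bar> = real_of_int k * \<bar>\<theta> - real_of_int h / real_of_int k\<bar>"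
    using k by (simp add: e_def abs_mult_pos' field_simps flip: abs_mult_pos')
  also have "\<dots> < real_of_int k * (1 / (real_of_int k)\<^sup>2)"
    using approx k by (intro mult_strict_left_mono) auto
  also have "\<dots> = 1 / real_of_int k"
    using k by (simp add: power2_eq_square)
  finally have e: "\<bar>e\<bar> < 1 / real_of_int k" .
  have "\<bar>e\<bar> * real_of_int k \<le> 1"
    using e k by (simp add: field_simps)
  moreover have "\<bar>e\<bar> * \<bar>e\<bar> \<le> 1 * 1"
    using e k by (intro mult_mono) (auto intro: order.trans[OF less_imp_le])
  moreover have "real_of_int (h\<^sup>2 - d * k\<^sup>2) = e * e - 2 * (e * real_of_int k) * \<theta>"
    using \<theta> by (simp add: e_def power2_eq_square algebra_simps)
  ultimately have "\<bar>real_of_int (h\<^sup>2 - d * k\<^sup>2)\<bar> \<le> 2 * \<bar>\<theta>\<bar> + 1"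
    using k abs_triangle_ineq4[of "e * e" "2 * (e * real_of_int k) * \<theta>"]
      mult_right_mono[of "\<bar>e\<bar> * real_of_int k" 1 "\<bar>\<theta>\<bar>"] by (simp add: abs_mult)
  thus ?thesis by linarith
qed

lemma coprime_fraction_unique:
  fixes h k h' k' :: int
  assumes "coprime h k" "coprime h' k'" "k > 0" "k' > 0" "h * k' = h' * k"
  shows "h = h' \<and> k = k'"
proof -
  have "k dvd k'"
    using assms by (metis coprime_commute coprime_dvd_mult_right_iff dvd_triv_right)
  moreover have "k' dvd k"
    using assms by (metis coprime_commute coprime_dvd_mult_right_iff dvd_triv_right)
  ultimately have "k = k'" using assms by (simp add: zdvd_antisym_nonneg)
  thus ?thesis using assms by simp
qed

text \<open>The classical pigeonhole argument: infinitely many Dirichlet approximations have bounded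
  norm, so two of them share the norm n and the residues modulo n. The quotient of the two
  corresponding elements is then an integral element of norm 1.\<close>

lemma pell_solution_exists:
  fixes \<theta> :: real and d :: int
  assumes \<theta>: "\<theta>\<^sup>2 = real_of_int d" and irr: "\<theta> \<notin> \<rat>"
  obtains x y :: int where "x\<^sup>2 - d * y\<^sup>2 = 1" "y \<noteq> 0"
proof -
  define B where "B = \<lceil>2 * \<bar>\<theta>\<bar> + 1\<rceil>"
  define N where "N = (\<lambda>(h, k). h\<^sup>2 - d * k\<^sup>2)"
  \<comment> \<open>The pigeonholes: the norm together with both residues modulo it. By the norm
    bound only finitely many values occur.\<close>
  define \<phi> where "\<phi> = (\<lambda>(h, k). (N (h, k), h mod N (h, k), k mod N (h, k)))"
  have N0: "N (h, k) \<noteq> 0" if "(h, k) \<in> approx_set \<theta>" for h k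
  proof
    assume "N (h, k) = 0"
    hence "h\<^sup>2 = d * k\<^sup>2" by (simp add: N_def)
    hence "(real_of_int h)\<^sup>2 = \<theta>\<^sup>2 * (real_of_int k)\<^sup>2"
      unfolding \<theta> by (metis of_int_mult of_int_power)
    hence "(\<theta> * real_of_int k)\<^sup>2 = (real_of_int h)\<^sup>2"
      by (simp add: power_mult_distrib)
    hence "\<theta> * real_of_int k = real_of_int h \<or> \<theta> * real_of_int k = - real_of_int h"
      by (simp only: power2_eq_iff)
    moreover have "k \<noteq> 0" using that by (auto simp: approx_set_def)
    ultimately have "\<theta> = real_of_int h / real_of_int k \<or> \<theta> = real_of_int (- h) / real_of_int k"
      by (auto simp: field_simps)
    thus False using irr by (metis Rats_divide Rats_of_int)
  qed
  have "\<phi> ` approx_set \<theta> \<subseteq> {-B..B} \<times> {-B..B} \<times> {-B..B}"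
  proof
    fix z assume "z \<in> \<phi> ` approx_set \<theta>"
    then obtain h k where hk: "(h, k) \<in> approx_set \<theta>" and z: "z = \<phi> (h, k)" by auto
    have b: "\<bar>N (h, k)\<bar> \<le> B"
      using approx_set_norm_bound[OF \<theta> hk] by (simp add: N_def B_def)
    have "\<bar>a mod N (h, k)\<bar> \<le> B" for a
      using abs_mod_less[OF N0[OF hk], of a] b by linarith
    thus "z \<in> {-B..B} \<times> {-B..B} \<times> {-B..B}" using b
      by (auto simp: z \<phi>_def abs_le_iff minus_le_iff)
  qed
  hence "finite (\<phi> ` approx_set \<theta>)" by (rule finite_subset) auto
  moreover have "infinite (approx_set \<theta>)"
    using irr rational_iff_finite_approx_set by blast
  ultimately have "\<not> inj_on \<phi> (approx_set \<theta>)" by (metis finite_image_iff)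
  then obtain h k h' k' where in1: "(h, k) \<in> approx_set \<theta>" and in2: "(h', k') \<in> approx_set \<theta>"
    and neq: "(h, k) \<noteq> (h', k')" and \<phi>eq: "\<phi> (h, k) = \<phi> (h', k')"
    by (auto simp: inj_on_def)
  define n where "n = N (h, k)"
  have n: "n \<noteq> 0" "n = h\<^sup>2 - d * k\<^sup>2" "n = h'\<^sup>2 - d * k'\<^sup>2"
    and mods: "h mod n = h' mod n" "k mod n = k' mod n"
    using \<phi>eq N0[OF in1] by (auto simp: \<phi>_def n_def N_def)
  obtain u where u: "h' = h + n * u"
    using mods(1) by (metis mod_eqE)
  obtain v where v: "k' = k + n * v"
    using mods(2) by (metis mod_eqE)
  \<comment> \<open>These are the coordinates of (h' + k' \<theta>) / (h + k \<theta>): multiplying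
    by the conjugate h - k \<theta> gives n (x + y \<theta>), as \<open>nx\<close> and
    \<open>ny\<close> record.\<close>
  define x where "x = 1 + h * u - d * k * v"
  define y where "y = h * v - k * u"
  have nx: "h * h' - d * k * k' = n * x"
    using n(2) by (simp add: u v x_def power2_eq_square algebra_simps)
  have ny: "h * k' - h' * k = n * y"
    by (simp add: u v y_def algebra_simps)
  have "n * n * (x\<^sup>2 - d * y\<^sup>2) = (n * x)\<^sup>2 - d * (n * y)\<^sup>2"
    by (simp add: power2_eq_square algebra_simps)
  also have "\<dots> = (h\<^sup>2 - d * k\<^sup>2) * (h'\<^sup>2 - d * k'\<^sup>2)"
    unfolding nx[symmetric] ny[symmetric] by (simp add: power2_eq_square algebra_simps)
  also have "\<dots> = n * n" using n by simp
  finally have "x\<^sup>2 - d * y\<^sup>2 = 1" using n(1) by simp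
  \<comment> \<open>A vanishing y would make the two fractions equal, but distinct pairs in
    \<open>approx_set\<close> are distinct reduced fractions.\<close>
  moreover have "y \<noteq> 0"
  proof
    assume "y = 0"
    hence "h * k' = h' * k" using ny by simp
    thus False
      using in1 in2 neq coprime_fraction_unique[of h k h' k'] by (auto simp: approx_set_def)
  qed
  ultimately show ?thesis by (rule that)
qed

text \<open>A Pell solution (X, Y) for d m^2 gives the unit X + m Y \<delta>, whose second
  coordinate is divisible by m. Its square is 1 + 2 d m^2 Y^2 + 2 X m Y \<delta>, so the first
  coordinate becomes 1 modulo m as well.\<close>

lemma pell_unit_near_one:
  fixes \<delta> :: real and d m :: int
  assumes \<delta>: "\<delta>\<^sup>2 = real_of_int d" "\<delta> \<notin> \<rat>" and m: "m \<noteq> 0"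
  obtains x y :: int where "m dvd x - 1" "m dvd y" "y \<noteq> 0"
    "real_of_int x - real_of_int y * \<delta> > 1"
    "real_of_int x + real_of_int y * \<delta> = 1 / (real_of_int x - real_of_int y * \<delta>)"
proof -
  have irr: "\<delta> * real_of_int m \<notin> \<rat>"
  proof
    assume "\<delta> * real_of_int m \<in> \<rat>"
    hence "\<delta> * real_of_int m / real_of_int m \<in> \<rat>" by (rule Rats_divide) simp
    thus False using \<delta>(2) m by simp
  qed
  have "(\<delta> * real_of_int m)\<^sup>2 = real_of_int (d * m\<^sup>2)" by (simp add: power_mult_distrib \<delta>(1))
  from pell_solution_exists[OF this irr] obtain X Y where
    XY: "X\<^sup>2 - d * m\<^sup>2 * Y\<^sup>2 = 1" "Y \<noteq> 0" by metis
  have \<delta>0: "\<delta> \<noteq> 0" using \<delta>(2) by auto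
  hence "real_of_int d > 0" by (simp flip: \<delta>(1))
  hence d0: "d > 0" by simp
  have X0: "X \<noteq> 0"
  proof
    assume "X = 0"
    moreover have "d * m\<^sup>2 * Y\<^sup>2 \<ge> 0" using d0 by simp
    ultimately show False using XY(1) by simp
  qed
  define y0 where "y0 = 2 * X * m * Y"
  \<comment> \<open>The sign is chosen so that y \<delta> is negative; this makes the conjugate x -
    y \<delta> the expanding embedding.\<close>
  define y where "y = (if real_of_int y0 * \<delta> < 0 then y0 else - y0)"
  define x where "x = 1 + 2 * d * m\<^sup>2 * Y\<^sup>2"
  have y0: "y0 \<noteq> 0" using X0 XY(2) m by (simp add: y0_def)
  have yy: "y\<^sup>2 = y0\<^sup>2" "y \<noteq> 0" using y0 by (auto simp: y_def)
  have "x\<^sup>2 - d * y\<^sup>2 = 1 + 4 * d * m\<^sup>2 * Y\<^sup>2 * (1 - (X\<^sup>2 - d * m\<^sup>2 * Y\<^sup>2))"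
    unfolding yy by (simp add: x_def y0_def power2_eq_square algebra_simps)
  hence norm: "x\<^sup>2 - d * y\<^sup>2 = 1" using XY(1) by simp
  have neg: "real_of_int y * \<delta> < 0"
    using y0 \<delta>0 by (auto simp: y_def not_less less_le)
  have "x \<ge> 1" using d0 by (simp add: x_def)
  hence gt: "real_of_int x - real_of_int y * \<delta> > 1" using neg by (smt (verit) of_int_1_le_iff)
  have "(real_of_int x + real_of_int y * \<delta>) * (real_of_int x - real_of_int y * \<delta>)
      = real_of_int (x\<^sup>2 - d * y\<^sup>2)"
    by (simp add: \<delta>(1)[symmetric] power2_eq_square algebra_simps)
  hence "real_of_int x + real_of_int y * \<delta> = 1 / (real_of_int x - real_of_int y * \<delta>)"
    using norm gt by (simp add: field_simps)
  moreover have "m dvd x - 1" by (simp add: x_def power2_eq_square)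
  moreover have "m dvd y" by (simp add: y_def y0_def)
  ultimately show ?thesis using gt yy(2) that by blast
qed

section \<open>Powers of a unit modulo prime powers\<close>

text \<open>\<open>qpow d (x, y) n\<close> is the pair \<open>(u, v)\<close> with \<open>u + v \<surd>d = (x + y \<surd>d)\<^sup>n\<close>.\<close>

primrec qpow :: "int \<Rightarrow> int \<times> int \<Rightarrow> nat \<Rightarrow> int \<times> int" where
  "qpow d z 0 = (1, 0)"
| "qpow d z (Suc n) = (fst z * fst (qpow d z n) + d * snd z * snd (qpow d z n),
                       fst z * snd (qpow d z n) + snd z * fst (qpow d z n))"

lemma qpow_add:
  "qpow d z (m + n) =
     (fst (qpow d z m) * fst (qpow d z n) + d * snd (qpow d z m) * snd (qpow d z n),
      fst (qpow d z m) * snd (qpow d z n) + snd (qpow d z m) * fst (qpow d z n))"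
  by (induction m) (auto simp: algebra_simps)

lemma qpow_mult: "qpow d z (m * n) = qpow d (qpow d z m) n"
  by (induction n) (auto simp: qpow_add)

text \<open>Only the square of \<delta> enters, so the lemma serves both real embeddings, given by
  \<delta> and by - \<delta>.\<close>

lemma qpow_real:
  fixes \<delta> :: real
  assumes "\<delta>\<^sup>2 = real_of_int d"
  shows "real_of_int (fst (qpow d z n)) + real_of_int (snd (qpow d z n)) * \<delta> =
    (real_of_int (fst z) + real_of_int (snd z) * \<delta>) ^ n"
proof (induction n)
  case (Suc n)
  show ?case
    unfolding power_Suc Suc.IH[symmetric] qpow.simps
    using assms by (simp add: power2_eq_square algebra_simps)
qed simp

lemma snd_dvd_qpow: "snd z dvd snd (qpow d z n)"
  by (induction n) auto

text \<open>This is (1 + \<epsilon>)^n = 1 + n \<epsilon> to first order. The error in the second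
  coordinate is a multiple of \<open>m * snd z\<close>, not merely of \<open>m\<close>; this
  relative precision lets valuations be tracked exactly.\<close>

lemma qpow_cong_1:
  assumes x: "m dvd fst z - 1" and y: "m dvd snd z"
  shows "m dvd fst (qpow d z n) - 1" "m * snd z dvd snd (qpow d z n) - int n * snd z"
proof (induction n)
  case (Suc n)
  obtain a b where z: "fst z = 1 + m * a" "snd z = m * b"
    using x y by (metis dvdE add.commute diff_add_cancel)
  obtain u where u: "fst (qpow d z n) = 1 + m * u"
    using Suc.IH(1) by (metis dvdE add.commute diff_add_cancel)
  obtain v where v: "snd (qpow d z n) = int n * snd z + m * snd z * v"
    using Suc.IH(2) by (metis dvdE add.commute diff_add_cancel)
  have "fst (qpow d z (Suc n)) - 1 = m * (a + u + m * a * u + d * b * snd (qpow d z n))"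
    by (simp add: u z algebra_simps)
  thus "m dvd fst (qpow d z (Suc n)) - 1" by simp
  have "snd (qpow d z (Suc n)) - int (Suc n) * snd z =
      m * snd z * (v + a * int n + m * a * v + u)"
    unfolding qpow.simps u v by (simp add: z algebra_simps)
  thus "m * snd z dvd snd (qpow d z (Suc n)) - int (Suc n) * snd z" by simp
qed auto

text \<open>Each p-th power raises the p-adic valuation of the second coordinate by exactly
  one.\<close>

lemma qpow_prime_power:
  fixes p :: nat
  assumes p: "prime p" and x: "int p ^ 2 dvd fst z - 1" and y: "int p ^ 2 dvd snd z"
    and w: "snd z = int p ^ w * u" "\<not> int p dvd u"
  shows "\<exists>u'. snd (qpow d z (p ^ k)) = int p ^ (w + k) * u' \<and> \<not> int p dvd u'"
proof (induction k)
  case 0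
  show ?case using w by auto
next
  case (Suc k)
  define Z where "Z = qpow d z (p ^ k)"
  obtain u' where u': "snd Z = int p ^ (w + k) * u'" "\<not> int p dvd u'"
    using Suc unfolding Z_def by blast
  have X: "int p ^ 2 dvd fst Z - 1"
    unfolding Z_def by (rule qpow_cong_1[OF x y])
  have Y: "int p ^ 2 dvd snd Z"
    unfolding Z_def using y snd_dvd_qpow by (rule dvd_trans)
  \<comment> \<open>Modulus p^2 makes the error one factor p smaller than the main term
    \<open>int p * snd Z\<close>. This covers p = 2 as well.\<close>
  obtain c where "snd (qpow d Z p) - int p * snd Z = int p ^ 2 * snd Z * c"
    using qpow_cong_1(2)[OF X Y, of d p] by (auto elim: dvdE)
  moreover have "qpow d z (p ^ Suc k) = qpow d Z p"
    by (simp only: power_Suc2 qpow_mult Z_def)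
  ultimately have "snd (qpow d z (p ^ Suc k)) = int p ^ (w + Suc k) * (u' * (1 + int p * c))"
    using u'(1) by (simp add: power2_eq_square algebra_simps)
  moreover have "\<not> int p dvd u' * (1 + int p * c)"
    using p u'(2) by (auto simp: prime_dvd_mult_iff dvd_add_left_iff)
  ultimately show ?case by blast
qed

text \<open>Hensel-type lifting towards the ratio A / B of the coordinates. Passing from n to n + j
  p^k changes the defect \<open>B * snd - A * fst\<close> by j u' B p^(w+k) to first order, and u' B
  is a unit modulo p, so a suitable j gains one more factor p.\<close>

lemma qpow_hits_residue:
  fixes p :: nat
  assumes p: "prime p" and x: "int p ^ 2 dvd fst z - 1" and y: "int p ^ 2 dvd snd z"
    and w: "snd z = int p ^ w * u" "\<not> int p dvd u"
    and A: "int p ^ w dvd A" "int p dvd A" and B: "\<not> int p dvd B"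
  shows "\<exists>n. k \<le> n \<and> n \<le> 2 * p ^ k \<and>
    int p ^ (w + k) dvd B * snd (qpow d z n) - A * fst (qpow d z n)"
proof (induction k)
  case 0
  show ?case using A by (intro exI[of _ 0]) auto
next
  case (Suc k)
  then obtain n where n: "k \<le> n" "n \<le> 2 * p ^ k"
    and dvd: "int p ^ (w + k) dvd B * snd (qpow d z n) - A * fst (qpow d z n)" by blast
  obtain e where e: "B * snd (qpow d z n) - A * fst (qpow d z n) = int p ^ (w + k) * e"
    using dvd by (auto elim: dvdE)
  define Z where "Z = qpow d z (p ^ k)"
  obtain u' where u': "snd Z = int p ^ (w + k) * u'" "\<not> int p dvd u'"
    using qpow_prime_power[OF p x y w] unfolding Z_def by blast
  have pp: "int p dvd int p ^ 2" by simp
  have X: "int p dvd fst Z - 1"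
    unfolding Z_def using qpow_cong_1(1)[OF x y] pp dvd_trans by blast
  have Y: "int p dvd snd Z"
    unfolding Z_def using dvd_trans[OF pp y] snd_dvd_qpow by (rule dvd_trans)
  have "coprime (int p) (u' * B)"
    using p u'(2) B by (simp add: prime_imp_coprime_int prime_dvd_mult_iff)
  then obtain r s where rs: "r * int p + s * (u' * B) = 1"
    by (metis bezout_int coprime_imp_gcd_eq_1)
  \<comment> \<open>j solves e + j u' B = 0 modulo p. The representative is taken in 1..p instead of
    0..p-1, so that n grows strictly and the bound \<open>k \<le> n\<close> survives the
    induction.\<close>
  define j where "j = nat (1 + (- s * e - 1) mod int p)"
  have p0: "int p > 0" using p by (simp add: prime_gt_0_nat)
  have j: "1 \<le> j" "j \<le> p"
    using pos_mod_bound[OF p0, of "- s * e - 1"] pos_mod_sign[OF p0, of "- s * e - 1"]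
    by (auto simp: j_def)
  have "int j mod int p = (- s * e) mod int p"
    using pos_mod_sign[OF p0, of "- s * e - 1"] by (simp add: j_def mod_simps)
  then obtain t where t: "int j = - s * e + int p * t" by (metis mod_eqE)
  have ej: "int p dvd e + int j * u' * B"
  proof -
    have "e + int j * u' * B = e * (1 - s * (u' * B)) + int p * (t * u' * B)"
      by (simp add: t algebra_simps)
    also have "\<dots> = int p * (e * r + t * u' * B)"
      using rs by (simp add: algebra_simps flip: rs)
    finally show ?thesis by simp
  qed
  define n' where "n' = n + p ^ k * j"
  have q: "qpow d z (p ^ k * j) = qpow d Z j" by (simp add: qpow_mult Z_def)
  obtain a where a: "fst (qpow d Z j) = 1 + int p * a"
    using qpow_cong_1(1)[OF X Y, of d j] by (metis dvdE add.commute diff_add_cancel)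
  obtain b where b: "snd (qpow d Z j) = int j * snd Z + int p * snd Z * b"
    using qpow_cong_1(2)[OF X Y, of d j] by (metis dvdE add.commute diff_add_cancel)
  obtain a' where a': "fst (qpow d z n) = 1 + int p * a'"
    using qpow_cong_1(1)[OF x y, of d n] pp by (metis dvdE dvd_trans add.commute diff_add_cancel)
  obtain A' where A': "A = int p * A'" using A(2) by (auto elim: dvdE)
  obtain c where c: "e + int j * u' * B = int p * c" using ej by (auto elim: dvdE)
  \<comment> \<open>The product formula for the defect. The factor of
    \<open>snd (qpow d Z j)\<close> is B modulo p, because p divides A and
    \<open>fst (qpow d z n)\<close> is 1 modulo p.\<close>
  have "B * snd (qpow d z n') - A * fst (qpow d z n') =
      fst (qpow d Z j) * (B * snd (qpow d z n) - A * fst (qpow d z n))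
      + snd (qpow d Z j) * (B * fst (qpow d z n) - A * d * snd (qpow d z n))"
    unfolding n'_def qpow_add q by (simp add: algebra_simps)
  also have "\<dots> = int p ^ (w + k) * ((1 + int p * a) * e + (int j + int p * b) * u' *
      (B * (1 + int p * a') - int p * A' * d * snd (qpow d z n)))"
    unfolding e unfolding a b a' u' A' by (simp add: algebra_simps)
  also have "(1 + int p * a) * e + (int j + int p * b) * u' *
      (B * (1 + int p * a') - int p * A' * d * snd (qpow d z n)) =
      (e + int j * u' * B) + int p * (a * e + b * u' * B +
        (int j + int p * b) * u' * (B * a' - A' * d * snd (qpow d z n)))"
    by (simp add: algebra_simps)
  finally have "int p ^ (w + Suc k) dvd B * snd (qpow d z n') - A * fst (qpow d z n')"
    unfolding c by (simp flip: distrib_left)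
  moreover have "Suc k \<le> n'"
  proof -
    have "p ^ k * j > 0" using prime_gt_0_nat[OF p] j by simp
    thus ?thesis using n unfolding n'_def by linarith
  qed
  moreover have "n' \<le> 2 * p ^ Suc k"
  proof -
    have "p ^ k * j \<le> p ^ k * p" "2 * p ^ k \<le> p * p ^ k"
      using j prime_ge_2_nat[OF p] by (auto intro: mult_le_mono)
    thus ?thesis using n(2) unfolding n'_def power_Suc mult.commute[of "p ^ k" p] by linarith
  qed
  ultimately show ?case by blast
qed

section \<open>Approximation of p-adic numbers along a unit orbit\<close>

context
  fixes p :: nat
  assumes p: "prime p"
begin

section \<open>p-adic size and divisibility\<close>

lemma padic_abs_of_int_le_1: "padic_abs p (of_int a) \<le> 1"
proof (cases "a = 0")
  case False
  have "real p powi (- int (multiplicity (int p) a)) \<le> real p powi 0"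
    using prime_ge_1_nat[OF p] by (intro power_int_increasing) auto
  thus ?thesis using padic_abs_of_int[OF p False] by simp
qed simp

lemma padic_abs_of_int_le_iff: "padic_abs p (of_int a) \<le> 1 / real p ^ k \<longleftrightarrow> int p ^ k dvd a"
proof (cases "a = 0")
  case False
  have p1: "1 < real p" using prime_gt_1_nat[OF p] by simp
  have "padic_abs p (of_int a) = 1 / real p ^ multiplicity (int p) a"
    using padic_abs_of_int[OF p False] by (simp add: power_int_minus inverse_eq_divide)
  hence "padic_abs p (of_int a) \<le> 1 / real p ^ k \<longleftrightarrow> real p ^ k \<le> real p ^ multiplicity (int p) a"
    using p1 by (simp only:) (simp add: divide_simps)
  also have "\<dots> \<longleftrightarrow> k \<le> multiplicity (int p) a"
    by (rule power_increasing_iff[OF p1])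
  also have "\<dots> \<longleftrightarrow> int p ^ k dvd a"
    using False not_prime_unit[of "int p"] p by (subst power_dvd_iff_le_multiplicity) auto
  finally show ?thesis .
qed simp

lemma padic_abs_of_int_eq_1: "\<not> int p dvd a \<Longrightarrow> padic_abs p (of_int a) = 1"
  using padic_abs_of_int[OF p, of a] not_dvd_imp_multiplicity_0[of "int p" a] by auto

text \<open>In lowest terms the numerator inherits the bound, as the denominator has absolute value
  at most 1. Since w > 0, p divides the numerator and hence not the denominator.\<close>

lemma padic_abs_le_fraction:
  assumes "padic_abs p t \<le> 1 / real p ^ w" "w > 0"
  obtains A B :: int where "t = of_int A / of_int B" "\<not> int p dvd B" "int p ^ w dvd A"
proof -
  obtain A B where AB: "quotient_of t = (A, B)" by fastforce
  have B: "B > 0" and t: "t = of_int A / of_int B" and cop: "coprime A B"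
    using quotient_of_denom_pos[OF AB] quotient_of_div[OF AB] quotient_of_coprime[OF AB] by auto
  have Bpos: "padic_abs p (of_int B) > 0"
    using B padic_abs_eq_0_iff[OF p, of "of_int B"] padic_abs_nonneg[OF p, of "of_int B"]
    by (metis less_eq_real_def of_int_eq_0_iff less_irrefl)
  have pw: "0 < 1 / real p ^ w" using prime_gt_0_nat[OF p] by simp
  have "padic_abs p (of_int A) / padic_abs p (of_int B) \<le> 1 / real p ^ w"
    using assms(1) B by (simp add: t padic_abs_of_int_over[OF p])
  hence "padic_abs p (of_int A) \<le> 1 / real p ^ w * padic_abs p (of_int B)"
    using Bpos by (simp add: pos_divide_le_eq)
  also have "\<dots> \<le> 1 / real p ^ w * 1"
    using pw padic_abs_of_int_le_1 by (intro mult_left_mono) auto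
  finally have A: "int p ^ w dvd A" by (simp add: padic_abs_of_int_le_iff)
  moreover have "int p dvd A" using A assms(2) by (metis dvd_power dvd_trans)
  hence "\<not> int p dvd B" using cop p by (metis coprime_common_divisor not_prime_unit prime_nat_int_transfer)
  ultimately show ?thesis using t that by blast
qed

text \<open>Writing h / g = A / B with B prime to p turns the form into g / B times the integer
  defect of \<open>qpow_hits_residue\<close>, and B has absolute value 1.\<close>

lemma qpow_linear_form_small:
  assumes x: "int p ^ 2 dvd fst z - 1" and y: "int p ^ 2 dvd snd z"
    and w: "snd z = int p ^ w * u" "\<not> int p dvd u"
    and g: "g \<noteq> 0" and h: "padic_abs p h \<le> padic_abs p g / real p ^ w"
  obtains n where "k \<le> n" "n \<le> 2 * p ^ k"
    "padic_abs p (of_int (snd (qpow d z n)) * g - of_int (fst (qpow d z n)) * h)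
       \<le> padic_abs p g / real p ^ (w + k)"
proof -
  have w0: "w > 0"
  proof (rule ccontr)
    assume "\<not> w > 0"
    hence "int p ^ 2 dvd u" using y w by simp
    thus False using w(2) by (meson dvd_power dvd_trans zero_less_numeral)
  qed
  have gpos: "padic_abs p g > 0"
    using g padic_abs_eq_0_iff[OF p, of g] padic_abs_nonneg[OF p, of g] by linarith
  have "padic_abs p (h / g) = padic_abs p h / padic_abs p g"
    by (simp add: divide_inverse padic_abs_mult[OF p] padic_abs_inverse[OF p])
  also have "\<dots> \<le> 1 / real p ^ w"
    using h gpos by (simp add: pos_divide_le_eq)
  finally obtain A B where AB: "h / g = of_int A / of_int B" "\<not> int p dvd B" "int p ^ w dvd A"
    using padic_abs_le_fraction w0 by metis
  have "int p dvd A" using AB(3) w0 by (metis dvd_power dvd_trans)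
  then obtain n where n: "k \<le> n" "n \<le> 2 * p ^ k"
    and dvd: "int p ^ (w + k) dvd B * snd (qpow d z n) - A * fst (qpow d z n)"
    using qpow_hits_residue[OF p x y w AB(3) _ AB(2)] by metis
  have B0: "(of_int B :: rat) \<noteq> 0" using AB(2) by auto
  have "h = g * (of_int A / of_int B)" using AB(1) g by (simp add: field_simps)
  hence "of_int B * (of_int (snd (qpow d z n)) * g - of_int (fst (qpow d z n)) * h) =
      g * of_int (B * snd (qpow d z n) - A * fst (qpow d z n))"
    using B0 by (simp add: field_simps)
  hence "padic_abs p (of_int B * (of_int (snd (qpow d z n)) * g - of_int (fst (qpow d z n)) * h))
     = padic_abs p g * padic_abs p (of_int (B * snd (qpow d z n) - A * fst (qpow d z n)))"
    by (simp only: padic_abs_mult[OF p])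
  hence "padic_abs p (of_int (snd (qpow d z n)) * g - of_int (fst (qpow d z n)) * h)
     = padic_abs p g * padic_abs p (of_int (B * snd (qpow d z n) - A * fst (qpow d z n)))"
    by (simp only: padic_abs_mult[OF p] padic_abs_of_int_eq_1[OF AB(2)] mult_1)
  also have "\<dots> \<le> padic_abs p g * (1 / real p ^ (w + k))"
    using dvd gpos by (intro mult_left_mono) (simp_all only: padic_abs_of_int_le_iff less_imp_le)
  finally show ?thesis using n that by simp
qed

section \<open>Computing in the field of p-adic numbers with representing Cauchy sequences\<close>

lemma Cauchy_ring_simps:
  "carrier (padic_Cauchy_ring p) = {s. padic_Cauchy p s}"
  "s \<otimes>\<^bsub>padic_Cauchy_ring p\<^esub> t = (\<lambda>n. s n * t n)"
  "s \<oplus>\<^bsub>padic_Cauchy_ring p\<^esub> t = (\<lambda>n. s n + t n)"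
  "\<one>\<^bsub>padic_Cauchy_ring p\<^esub> = (\<lambda>n. 1)"
  "\<zero>\<^bsub>padic_Cauchy_ring p\<^esub> = (\<lambda>n. 0)"
  by (auto simp: padic_Cauchy_ring_def)

lemma Qp_carrierE:
  assumes "\<beta> \<in> carrier (Qp p)"
  obtains s where "padic_Cauchy p s" "\<beta> = padic_null p +>\<^bsub>padic_Cauchy_ring p\<^esub> s"
  using assms unfolding Qp_def FactRing_def A_RCOSETS_def'
  by (auto simp: Cauchy_ring_simps)

lemma Cauchy_ring_add_pow_nat:
  fixes k :: nat
  assumes "padic_Cauchy p s"
  shows "[k] \<cdot>\<^bsub>padic_Cauchy_ring p\<^esub> s = (\<lambda>n. of_nat k * s n)"
proof -
  interpret cring "padic_Cauchy_ring p" by (rule padic_Cauchy_ring_cring[OF p])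
  show ?thesis
    using assms by (induction k) (auto simp: algebra_simps Cauchy_ring_simps)
qed

lemma Cauchy_ring_add_pow:
  fixes k :: int
  assumes "padic_Cauchy p s"
  shows "[k] \<cdot>\<^bsub>padic_Cauchy_ring p\<^esub> s = (\<lambda>n. of_int k * s n)"
proof (cases "k \<ge> 0")
  case True
  thus ?thesis by (simp add: add_pow_int_ge Cauchy_ring_add_pow_nat[OF assms])
next
  case False
  have "(\<lambda>n. of_nat (nat (- k)) * s n) \<in> carrier (padic_Cauchy_ring p)"
    using padic_Cauchy_mult[OF p padic_Cauchy_const[OF p] assms] by (simp add: Cauchy_ring_simps)
  thus ?thesis using False
    by (simp add: add_pow_int_lt Cauchy_ring_add_pow_nat[OF assms] padic_Cauchy_ring_uminus[OF p])
qed

lemma Cauchy_ring_pow: "s [^]\<^bsub>padic_Cauchy_ring p\<^esub> (i::nat) = (\<lambda>n. s n ^ i)"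
  by (induction i) (auto simp: mult.commute Cauchy_ring_simps)

lemma Cauchy_power: "padic_Cauchy p s \<Longrightarrow> padic_Cauchy p (\<lambda>n. s n ^ i)"
  by (induction i) (auto simp: padic_Cauchy_mult[OF p] padic_Cauchy_const[OF p])

lemma Cauchy_ring_finsum:
  assumes "finite I" "\<And>i. i \<in> I \<Longrightarrow> padic_Cauchy p (t i)"
  shows "(\<Oplus>\<^bsub>padic_Cauchy_ring p\<^esub>i\<in>I. t i) = (\<lambda>n. \<Sum>i\<in>I. t i n)"
proof -
  interpret cring "padic_Cauchy_ring p" by (rule padic_Cauchy_ring_cring[OF p])
  show ?thesis using assms
  proof (induction I rule: finite_induct)
    case empty
    show ?case by (simp add: finsum_empty Cauchy_ring_simps)
  next
    case (insert i I)
    have "finsum (padic_Cauchy_ring p) t (insert i I) = 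
        t i \<oplus>\<^bsub>padic_Cauchy_ring p\<^esub> finsum (padic_Cauchy_ring p) t I"
      using insert by (intro finsum_insert) (auto simp: Cauchy_ring_simps)
    thus ?case using insert by (simp add: Cauchy_ring_simps)
  qed
qed

lemma Qp_coset_hom: "ring_hom_cring (padic_Cauchy_ring p) (Qp p) ((+>\<^bsub>padic_Cauchy_ring p\<^esub>) (padic_null p))"
  unfolding Qp_def by (rule ideal.rcos_ring_hom_cring[OF padic_null_ideal[OF p] padic_Cauchy_ring_cring[OF p]])

text \<open>Integer multiples are powers in the additive group, and the quotient map is a
  homomorphism of additive groups.\<close>

lemma Qp_add_pow:
  fixes k :: int
  assumes "padic_Cauchy p s"
  shows "[k] \<cdot>\<^bsub>Qp p\<^esub> (padic_null p +>\<^bsub>padic_Cauchy_ring p\<^esub> s) =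
    padic_null p +>\<^bsub>padic_Cauchy_ring p\<^esub> (\<lambda>n. of_int k * s n)"
proof -
  interpret h: ring_hom_cring "padic_Cauchy_ring p" "Qp p" "(+>\<^bsub>padic_Cauchy_ring p\<^esub>) (padic_null p)"
    by (rule Qp_coset_hom)
  have "group_hom (add_monoid (padic_Cauchy_ring p)) (add_monoid (Qp p))
      ((+>\<^bsub>padic_Cauchy_ring p\<^esub>) (padic_null p))"
    by (intro group_hom.intro group_hom_axioms.intro h.R.a_group h.S.a_group)
      (auto simp: hom_def)
  from group_hom.hom_int_pow[OF this, of s k]
  have "padic_null p +>\<^bsub>padic_Cauchy_ring p\<^esub> ([k] \<cdot>\<^bsub>padic_Cauchy_ring p\<^esub> s) =
      [k] \<cdot>\<^bsub>Qp p\<^esub> (padic_null p +>\<^bsub>padic_Cauchy_ring p\<^esub> s)"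
    using assms by (simp add: add_pow_def Cauchy_ring_simps(1))
  thus ?thesis by (simp add: Cauchy_ring_add_pow[OF assms])
qed

text \<open>Brings the linear form at \<beta> into coset shape, where \<open>Qp_norm_coset\<close>
  computes its norm as a limit.\<close>

lemma Qp_linear_form:
  fixes q r :: int
  assumes s: "padic_Cauchy p s"
  shows "[q] \<cdot>\<^bsub>Qp p\<^esub> (padic_null p +>\<^bsub>padic_Cauchy_ring p\<^esub> s)
      \<ominus>\<^bsub>Qp p\<^esub> [r] \<cdot>\<^bsub>Qp p\<^esub> \<one>\<^bsub>Qp p\<^esub> =
    padic_null p +>\<^bsub>padic_Cauchy_ring p\<^esub> (\<lambda>n. of_int q * s n - of_int r)"
proof -
  interpret h: ring_hom_cring "padic_Cauchy_ring p" "Qp p" "(+>\<^bsub>padic_Cauchy_ring p\<^esub>) (padic_null p)"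
    by (rule Qp_coset_hom)
  have car: "(\<lambda>n. of_int q * s n) \<in> carrier (padic_Cauchy_ring p)"
    "(\<lambda>n. of_int r) \<in> carrier (padic_Cauchy_ring p)"
    using padic_Cauchy_mult[OF p padic_Cauchy_const[OF p] s] padic_Cauchy_const[OF p]
    by (auto simp: Cauchy_ring_simps)
  have one: "\<one>\<^bsub>Qp p\<^esub> = padic_null p +>\<^bsub>padic_Cauchy_ring p\<^esub> (\<lambda>n. 1)"
    using h.hom_one by (simp add: Cauchy_ring_simps)
  have "(\<lambda>n. of_int q * s n - of_int r) =
      (\<lambda>n. of_int q * s n) \<ominus>\<^bsub>padic_Cauchy_ring p\<^esub> (\<lambda>n. of_int r)"
    using padic_Cauchy_ring_uminus[OF p car(2)] by (simp add: a_minus_def Cauchy_ring_simps)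
  thus ?thesis unfolding one
    using car by (simp add: Qp_add_pow[OF s] Qp_add_pow[OF padic_Cauchy_const[OF p]] a_minus_def)
qed

text \<open>Translates the non-vanishing of f at \<beta> into a statement about a sequence of
  rationals.\<close>

lemma Qp_eval_coset:
  assumes s: "padic_Cauchy p s"
  shows "Qp_eval p f (padic_null p +>\<^bsub>padic_Cauchy_ring p\<^esub> s) =
    padic_null p +>\<^bsub>padic_Cauchy_ring p\<^esub> (\<lambda>n. \<Sum>i\<le>degree f. of_int (coeff f i) * s n ^ i)"
proof -
  interpret h: ring_hom_cring "padic_Cauchy_ring p" "Qp p" "(+>\<^bsub>padic_Cauchy_ring p\<^esub>) (padic_null p)"
    by (rule Qp_coset_hom)
  have hr: "ring_hom_ring (padic_Cauchy_ring p) (Qp p) ((+>\<^bsub>padic_Cauchy_ring p\<^esub>) (padic_null p))"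
    unfolding Qp_def by (rule ideal.rcos_ring_hom_ring[OF padic_null_ideal[OF p]])
  have car: "s \<in> carrier (padic_Cauchy_ring p)" using s by (simp add: Cauchy_ring_simps)
  have C: "padic_Cauchy p (\<lambda>n. of_int (coeff f i) * s n ^ i)" for i
    by (intro padic_Cauchy_mult[OF p] padic_Cauchy_const[OF p] Cauchy_power s)
  have "Qp_eval p f (padic_null p +>\<^bsub>padic_Cauchy_ring p\<^esub> s) =
     (\<Oplus>\<^bsub>Qp p\<^esub>i\<in>{..degree f}. padic_null p +>\<^bsub>padic_Cauchy_ring p\<^esub> (\<lambda>n. of_int (coeff f i) * s n ^ i))"
    unfolding Qp_eval_def
    by (simp add: ring_hom_ring.hom_nat_pow[OF hr car, symmetric] Cauchy_ring_pow
        Qp_add_pow[OF Cauchy_power[OF s]])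
  also have "\<dots> = padic_null p +>\<^bsub>padic_Cauchy_ring p\<^esub>
      (\<Oplus>\<^bsub>padic_Cauchy_ring p\<^esub>i\<in>{..degree f}. (\<lambda>n. of_int (coeff f i) * s n ^ i))"
    using C by (subst h.hom_finsum) (auto simp: o_def Cauchy_ring_simps)
  finally show ?thesis by (simp add: Cauchy_ring_finsum C)
qed

lemma Qp_coset_eq_zero:
  assumes "s \<in> padic_null p"
  shows "padic_null p +>\<^bsub>padic_Cauchy_ring p\<^esub> s = \<zero>\<^bsub>Qp p\<^esub>"
proof -
  interpret ideal "padic_null p" "padic_Cauchy_ring p" by (rule padic_null_ideal[OF p])
  show ?thesis using a_rcos_const[OF assms] by (simp add: Qp_def FactRing_def)
qed

section \<open>Small p-adic linear forms along the orbit\<close>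

text \<open>The orbit starts at numerator and denominator of a term \<open>s N\<close> close to
  \<beta>. Along it the form at \<open>s M\<close> is, up to the factor \<open>- Q\<^sub>0\<close>,
  \<open>snd * g - fst * h\<close> with \<open>g\<close> close to 2 f(\<beta>) and
  \<open>h = s M - s N\<close> small, so \<open>qpow_linear_form_small\<close> applies.\<close>

lemma padic_approximations_in_orbit:
  fixes a b c d :: int
  assumes s: "padic_Cauchy p s"
    and nz: "(\<lambda>m. of_int a * s m ^ 2 + of_int b * s m + of_int c) \<notin> padic_null p"
    and x: "int p ^ 2 dvd fst z - 1" and y: "int p ^ 2 dvd snd z" "snd z \<noteq> 0"
  obtains Q\<^sub>0 R\<^sub>0 K where "Q\<^sub>0 \<noteq> 0"
    "\<And>k. \<exists>n\<ge>k. real n * Qp_norm p (padic_null p +>\<^bsub>padic_Cauchy_ring p\<^esub>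
        (\<lambda>m. of_int (fst (qpow d z n) * Q\<^sub>0 - snd (qpow d z n) * (b * Q\<^sub>0 + 2 * a * R\<^sub>0)) * s m
           - of_int (fst (qpow d z n) * R\<^sub>0 + snd (qpow d z n) * (2 * c * Q\<^sub>0 + b * R\<^sub>0)))) \<le> K"
proof -
  note pm = padic_abs_mult[OF p] and tri = padic_abs_triangle[OF p] and nn = padic_abs_nonneg[OF p]
  define w where "w = multiplicity (int p) (snd z)"
  obtain u where u: "snd z = int p ^ w * u" "\<not> int p dvd u"
    using multiplicity_decompose'[of "snd z" "int p"] y(2) p not_prime_unit[of "int p"]
    unfolding w_def by (metis prime_nat_int_transfer)
  have p0: "real p > 0" using prime_gt_0_nat[OF p] by simp
  define F where "F m = of_int a * s m ^ 2 + of_int b * s m + of_int c" for m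
  \<comment> \<open>The polarization of 2 F, so that g t t is twice the value of the quadratic
    polynomial at t.\<close>
  define g where "g t t' = of_int (2 * a) * (t * t') + of_int b * (t + t') + of_int (2 * c)" for t t' :: rat
  have "padic_Cauchy p F" unfolding F_def
    by (intro padic_Cauchy_add[OF p] padic_Cauchy_mult[OF p] padic_Cauchy_const[OF p] Cauchy_power s)
  then obtain L where L: "(\<lambda>m. padic_abs p (F m)) \<longlonglongrightarrow> L"
    using padic_Cauchy_convergent[OF p] by (auto simp: convergent_def)
  have "L \<ge> 0" by (rule LIMSEQ_le_const[OF L]) (auto intro: nn)
  moreover have "L \<noteq> 0" using L nz by (auto simp: padic_null_def F_def)
  ultimately have L0: "L > 0" by simp
  obtain B where B: "B > 0" "\<And>m. padic_abs p (s m) \<le> B" using padic_Cauchy_bounded[OF p s] by metis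
  \<comment> \<open>An eventual lower bound for the absolute value of 2 F; the factor
    \<open>padic_abs p 2\<close> is not 1 when p = 2.\<close>
  define G where "G = padic_abs p 2 * (L / 2)"
  have "padic_abs p 2 > 0"
    using nn[of 2] padic_abs_eq_0_iff[OF p, of 2] by (metis less_eq_real_def zero_neq_numeral)
  hence G0: "G > 0" using L0 by (simp add: G_def)
  \<comment> \<open>The first bound keeps \<open>g (s m) (s N)\<close> within G / 2 of 2 F; the
    second gives the smallness of h relative to g that the lifting requires.\<close>
  define e where "e = min (G / (2 * (B + 1))) (G / (2 * real p ^ w))"
  have e0: "e > 0" using G0 B p0 by (simp add: e_def)
  obtain N1 where N1: "\<And>m. m \<ge> N1 \<Longrightarrow> padic_abs p (F m) > L / 2"
    using order_tendstoD(1)[OF L, of "L / 2"] L0 by (auto simp: eventually_sequentially)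
  obtain N2 where N2: "\<And>m n. m \<ge> N2 \<Longrightarrow> n \<ge> N2 \<Longrightarrow> padic_abs p (s m - s n) < e"
    using s e0 unfolding padic_Cauchy_def by metis
  \<comment> \<open>N, and with it the starting vector, is fixed before k.\<close>
  define N where "N = max N1 N2"
  obtain R\<^sub>0 Q\<^sub>0 where RQ: "quotient_of (s N) = (R\<^sub>0, Q\<^sub>0)" by fastforce
  have Q0: "Q\<^sub>0 > 0" and sN: "s N = of_int R\<^sub>0 / of_int Q\<^sub>0"
    using quotient_of_denom_pos[OF RQ] quotient_of_div[OF RQ] by auto
  have int_le: "padic_abs p (of_int i * t) \<le> padic_abs p t" for i t
    using mult_right_mono[OF padic_abs_of_int_le_1[of i] nn[of t]] by (simp add: pm)
  have g_lower: "padic_abs p (g (s m) (s N)) \<ge> G / 2"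
    and small: "padic_abs p (s m - s N) \<le> padic_abs p (g (s m) (s N)) / real p ^ w"
    if m: "m \<ge> N" for m
  proof -
    have close: "padic_abs p (s m - s N) < e" using N2 m by (simp add: N_def)
    have "padic_abs p (of_int (2 * a) * s m + of_int b) \<le> B + 1"
      using tri[of "of_int (2 * a) * s m" "of_int b"] int_le[of "2 * a" "s m"] B(2)[of m]
        padic_abs_of_int_le_1[of b] by linarith
    hence "padic_abs p ((s m - s N) * (of_int (2 * a) * s m + of_int b)) \<le> e * (B + 1)"
      unfolding pm using close e0 by (intro mult_mono nn) auto
    also have "\<dots> \<le> G / (2 * (B + 1)) * (B + 1)"
      using B by (intro mult_right_mono) (auto simp: e_def)
    also have "\<dots> = G / 2" using B(1) by (simp add: field_simps)
    finally have 1: "padic_abs p ((s m - s N) * (of_int (2 * a) * s m + of_int b)) \<le> G / 2" .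
    have "G \<le> padic_abs p 2 * padic_abs p (F m)"
      unfolding G_def using N1[of m] m by (intro mult_left_mono nn) (auto simp: N_def)
    also have "\<dots> = padic_abs p (2 * F m)" by (simp add: pm)
    also have "2 * F m = g (s m) (s N) + (s m - s N) * (of_int (2 * a) * s m + of_int b)"
      by (simp add: F_def g_def power2_eq_square algebra_simps)
    also have "padic_abs p \<dots> \<le> padic_abs p (g (s m) (s N)) + G / 2"
      using tri[of "g (s m) (s N)" "(s m - s N) * (of_int (2 * a) * s m + of_int b)"] 1 by linarith
    finally show "padic_abs p (g (s m) (s N)) \<ge> G / 2" by simp
    hence "G / (2 * real p ^ w) \<le> padic_abs p (g (s m) (s N)) / real p ^ w"
      using p0 by (simp add: field_simps)
    thus "padic_abs p (s m - s N) \<le> padic_abs p (g (s m) (s N)) / real p ^ w"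
      using close by (simp add: e_def)
  qed
  define K where "K = B * B + 2 * B + 1"
  have K0: "K \<ge> 0" using B by (simp add: K_def)
  have g_upper: "padic_abs p (g (s m) (s N)) \<le> K" for m
  proof -
    have "padic_abs p (s m * s N) \<le> B * B"
      unfolding pm using B by (intro mult_mono nn) auto
    thus ?thesis unfolding g_def K_def
      using tri[of "of_int (2 * a) * (s m * s N) + of_int b * (s m + s N)" "of_int (2 * c)"]
        tri[of "of_int (2 * a) * (s m * s N)" "of_int b * (s m + s N)"] tri[of "s m" "s N"]
        int_le[of "2 * a" "s m * s N"] int_le[of b "s m + s N"] padic_abs_of_int_le_1[of "2 * c"]
        B(2)[of m] B(2)[of N] by linarith
  qed
  have approx: "\<exists>n\<ge>k. real n * Qp_norm p (padic_null p +>\<^bsub>padic_Cauchy_ring p\<^esub>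
        (\<lambda>m. of_int (fst (qpow d z n) * Q\<^sub>0 - snd (qpow d z n) * (b * Q\<^sub>0 + 2 * a * R\<^sub>0)) * s m
           - of_int (fst (qpow d z n) * R\<^sub>0 + snd (qpow d z n) * (2 * c * Q\<^sub>0 + b * R\<^sub>0))))
      \<le> 2 * (K + 1)" for k
  proof -
    \<comment> \<open>For each k a further term \<open>s M\<close> stands in for \<beta>: replacing
      it by any later term changes the form by at most p^(-k).\<close>
    obtain N3 where N3: "\<And>m n. m \<ge> N3 \<Longrightarrow> n \<ge> N3 \<Longrightarrow> padic_abs p (s m - s n) < 1 / real p ^ k"
      using s p0 unfolding padic_Cauchy_def by (metis zero_less_divide_1_iff zero_less_power)
    define M where "M = max N N3"
    have M: "M \<ge> N" "M \<ge> N3" by (auto simp: M_def)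
    have "g (s M) (s N) \<noteq> 0" using g_lower[OF M(1)] G0 by auto
    then obtain n where n: "k \<le> n" "n \<le> 2 * p ^ k" and
      le: "padic_abs p (of_int (snd (qpow d z n)) * g (s M) (s N) - of_int (fst (qpow d z n)) * (s M - s N))
       \<le> padic_abs p (g (s M) (s N)) / real p ^ (w + k)"
      using qpow_linear_form_small[OF x y(1) u _ small[OF M(1)], of k d] by metis
    define Q where "Q = fst (qpow d z n) * Q\<^sub>0 - snd (qpow d z n) * (b * Q\<^sub>0 + 2 * a * R\<^sub>0)"
    define R where "R = fst (qpow d z n) * R\<^sub>0 + snd (qpow d z n) * (2 * c * Q\<^sub>0 + b * R\<^sub>0)"
    have R0: "of_int R\<^sub>0 = of_int Q\<^sub>0 * s N" using Q0 by (simp add: sN)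
    \<comment> \<open>The integer factor \<open>- Q\<^sub>0\<close> has absolute value at most 1 and
      so cannot spoil the bound.\<close>
    have "of_int Q * s M - of_int R = of_int (- Q\<^sub>0) *
        (of_int (snd (qpow d z n)) * g (s M) (s N) - of_int (fst (qpow d z n)) * (s M - s N))"
      by (simp add: Q_def R_def g_def R0 algebra_simps)
    hence "padic_abs p (of_int Q * s M - of_int R) \<le> padic_abs p (g (s M) (s N)) / real p ^ (w + k)"
      using int_le le order_trans by metis
    also have "\<dots> \<le> K / real p ^ k"
      using g_upper[of M] K0 p0 prime_ge_1_nat[OF p] by (intro frac_le) (auto intro: power_increasing)
    finally have 1: "padic_abs p (of_int Q * s M - of_int R) \<le> K / real p ^ k" .
    have "padic_abs p (of_int Q * s m - of_int R) \<le> (K + 1) / real p ^ k" if "m \<ge> M" for m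
    proof -
      have 2: "padic_abs p (of_int Q * (s m - s M)) \<le> 1 / real p ^ k"
        using int_le[of Q "s m - s M"] N3[of m M] M that by linarith
      have eq: "of_int Q * s m - of_int R = (of_int Q * s M - of_int R) + of_int Q * (s m - s M)"
        by (simp add: algebra_simps)
      show ?thesis unfolding eq add_divide_distrib
        using tri[of "of_int Q * s M - of_int R" "of_int Q * (s m - s M)"] 1 2 by linarith
    qed
    moreover have C: "padic_Cauchy p (\<lambda>m. of_int Q * s m - of_int R)"
      using padic_Cauchy_add[OF p padic_Cauchy_mult[OF p padic_Cauchy_const[OF p, of "of_int Q"] s]
          padic_Cauchy_const[OF p, of "- of_int R"]] by simp
    ultimately have "Qp_norm p (padic_null p +>\<^bsub>padic_Cauchy_ring p\<^esub> (\<lambda>m. of_int Q * s m - of_int R))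
        \<le> (K + 1) / real p ^ k"
      by (intro LIMSEQ_le_const2[OF Qp_norm_coset[OF p C]]) blast
    hence "real n * Qp_norm p (padic_null p +>\<^bsub>padic_Cauchy_ring p\<^esub> (\<lambda>m. of_int Q * s m - of_int R))
        \<le> real n * ((K + 1) / real p ^ k)" by (intro mult_left_mono) auto
    \<comment> \<open>Here \<open>n \<le> 2 * p ^ k\<close> turns the bound O(p^(-k)) into
      O(1/n).\<close>
    also have "\<dots> \<le> real (2 * p ^ k) * ((K + 1) / real p ^ k)"
      using n(2) K0 by (intro mult_right_mono) (auto simp del: of_nat_mult of_nat_power)
    also have "\<dots> = 2 * (K + 1)" using p0 by simp
    finally show ?thesis using n(1) unfolding Q_def R_def by blast
  qed
  show ?thesis by (rule that[OF _ approx]) (use Q0 in simp)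
qed

lemma Qp_norm_nonneg:
  assumes "padic_Cauchy p s"
  shows "Qp_norm p (padic_null p +>\<^bsub>padic_Cauchy_ring p\<^esub> s) \<ge> 0"
  by (rule LIMSEQ_le_const[OF Qp_norm_coset[OF p assms]]) (auto intro: padic_abs_nonneg[OF p])

end

section \<open>Irreducible polynomials of real quadratic numbers\<close>

lemma poly_of_int_mult:
  "poly (map_poly real_of_int (g * h)) x = poly (map_poly real_of_int g) x * poly (map_poly real_of_int h) x"
proof -
  have "map_poly real_of_int (g * h) = map_poly real_of_int g * map_poly real_of_int h"
    by (intro poly_eqI) (simp add: coeff_map_poly coeff_mult)
  thus ?thesis by simp
qed

lemma poly_of_int_add:
  "poly (map_poly real_of_int (g + h)) x = poly (map_poly real_of_int g) x + poly (map_poly real_of_int h) x"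
proof -
  have "map_poly real_of_int (g + h) = map_poly real_of_int g + map_poly real_of_int h"
    by (intro poly_eqI) (simp add: coeff_map_poly)
  thus ?thesis by simp
qed

lemma poly_of_int_smult:
  "poly (map_poly real_of_int (smult c g)) x = real_of_int c * poly (map_poly real_of_int g) x"
proof -
  have "map_poly real_of_int (smult c g) = smult (real_of_int c) (map_poly real_of_int g)"
    by (intro poly_eqI) (simp add: coeff_map_poly)
  thus ?thesis by simp
qed

lemma alg_degree_le:
  fixes h :: "int poly"
  assumes "h \<noteq> 0" "poly (map_poly real_of_int h) x = 0"
  shows "alg_degree x \<le> degree h"
  unfolding alg_degree_def
proof (rule Least_le, intro exI conjI)
  show "map_poly rat_of_int h \<noteq> 0" using assms(1) by (simp add: map_poly_eq_0_iff)
  show "degree (map_poly rat_of_int h) = degree h" by (simp add: degree_map_poly)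
  have "map_poly of_rat (map_poly rat_of_int h) = map_poly real_of_int h"
    by (subst map_poly_map_poly) (auto simp: o_def)
  thus "poly (map_poly of_rat (map_poly rat_of_int h)) x = 0" using assms(2) by simp
qed

lemma real_quadratic_irrational:
  assumes "real_quadratic x"
  shows "x \<notin> \<rat>"
proof
  assume "x \<in> \<rat>"
  then obtain r where r: "x = of_rat r" by (auto elim: Rats_cases)
  have "alg_degree x \<le> 1" unfolding alg_degree_def
    by (rule Least_le, rule exI[of _ "[:- r, 1:]"]) (simp add: r map_poly_pCons of_rat_minus)
  thus False using assms by (simp add: real_quadratic_def)
qed

text \<open>Clears denominators in a rational polynomial of minimal degree annihilating
  \<open>x\<close>.\<close>

lemma real_quadratic_int_poly:
  assumes "real_quadratic x" "f \<noteq> 0" "poly (map_poly real_of_int f) x = 0"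
  obtains g :: "int poly" where "degree g = 2" "poly (map_poly real_of_int g) x = 0"
proof -
  \<comment> \<open>The least degree in \<open>alg_degree\<close> is attained because f shows that
    some annihilating polynomial exists.\<close>
  have "\<exists>d. \<exists>g :: rat poly. g \<noteq> 0 \<and> degree g = d \<and> poly (map_poly of_rat g) x = 0"
  proof (intro exI conjI)
    show "map_poly rat_of_int f \<noteq> 0" using assms by (simp add: map_poly_eq_0_iff)
    have "map_poly of_rat (map_poly rat_of_int f) = map_poly real_of_int f"
      by (subst map_poly_map_poly) (auto simp: o_def)
    thus "poly (map_poly of_rat (map_poly rat_of_int f)) x = 0" using assms by simp
  qed auto
  from LeastI_ex[OF this] obtain g :: "rat poly" where
    g: "g \<noteq> 0" "degree g = 2" "poly (map_poly of_rat g) x = 0"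
    using assms(1) unfolding real_quadratic_def alg_degree_def by auto
  have frac: "\<exists>n d. r = of_int n / of_int d \<and> d \<noteq> 0" for r :: rat
    by (metis quotient_of_div quotient_of_denom_pos surj_pair less_irrefl)
  obtain a1 a2 where a: "coeff g 2 = of_int a1 / of_int a2" "a2 \<noteq> 0" using frac by blast
  obtain b1 b2 where b: "coeff g 1 = of_int b1 / of_int b2" "b2 \<noteq> 0" using frac by blast
  obtain c1 c2 where c: "coeff g 0 = of_int c1 / of_int c2" "c2 \<noteq> 0" using frac by blast
  have "coeff g 2 \<noteq> 0" using g leading_coeff_0_iff[of g] by simp
  hence a1: "a1 \<noteq> 0" using a by auto
  let ?G = "[:c1 * a2 * b2, b1 * a2 * c2, a1 * b2 * c2:]"
  have "poly (map_poly of_rat g) x = of_rat (coeff g 0) + of_rat (coeff g 1) * x + of_rat (coeff g 2) * x ^ 2"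
    using g(2) by (simp add: poly_altdef coeff_map_poly degree_map_poly numeral_2_eq_2)
  hence "real_of_int c1 / of_int c2 + real_of_int b1 / of_int b2 * x + real_of_int a1 / of_int a2 * x ^ 2 = 0"
    using g(3) by (simp only: a b c of_rat_divide of_rat_of_int_eq)
  moreover have "poly (map_poly real_of_int ?G) x = real_of_int (a2 * b2 * c2) *
      (real_of_int c1 / of_int c2 + real_of_int b1 / of_int b2 * x + real_of_int a1 / of_int a2 * x ^ 2)"
    using a(2) b(2) c(2) by (simp add: map_poly_pCons power2_eq_square field_simps)
  ultimately have "poly (map_poly real_of_int ?G) x = 0" by simp
  moreover have "degree ?G = 2" using a b c a1 by simp
  ultimately show ?thesis using that by blast
qed

text \<open>Gauss' lemma in disguise: pseudo-division shows that \<open>g\<close> divides a multiple \<open>c f\<close> of \<open>f\<close>, and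
  \<open>f\<close> is prime in \<open>\<int>[X]\<close>.\<close>

lemma irreducible_degree_real_quadratic:
  assumes x: "real_quadratic x" and f: "irreducible f" "poly (map_poly real_of_int f) x = 0"
  shows "degree f = 2"
proof -
  have f0: "f \<noteq> 0" using f(1) by auto
  have ge: "degree h \<ge> 2" if "h \<noteq> 0" "poly (map_poly real_of_int h) x = 0" for h :: "int poly"
    using alg_degree_le[OF that] x by (simp add: real_quadratic_def)
  obtain g where g: "degree g = 2" "poly (map_poly real_of_int g) x = 0"
    using real_quadratic_int_poly[OF x f0 f(2)] .
  have g0: "g \<noteq> 0" using g by auto
  obtain q r where qr: "pseudo_divmod f g = (q, r)" by fastforce
  define c where "c = coeff g (degree g) ^ (Suc (degree f) - degree g)"
  have c0: "c \<noteq> 0" using g0 by (simp add: c_def)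
  have eq: "smult c f = g * q + r" and r: "r = 0 \<or> degree r < degree g"
    using pseudo_divmod[OF g0 qr] by (auto simp: c_def)
  have "poly (map_poly real_of_int r) x = 0"
    using arg_cong[OF eq, of "\<lambda>h. poly (map_poly real_of_int h) x"] f(2) g(2)
    by (simp add: poly_of_int_add poly_of_int_mult poly_of_int_smult)
  \<comment> \<open>A nonzero remainder would annihilate \<open>x\<close> in degree below 2.\<close>
  hence "r = 0" using r g(1) ge[of r] by linarith
  hence eq: "smult c f = g * q" using eq by simp
  have "prime_elem f" using f(1) by (rule irreducible_imp_prime_elem)
  moreover have "f dvd g * q" unfolding eq[symmetric] by (rule dvd_smult) simp
  ultimately consider "f dvd g" | "f dvd q" by (auto simp: prime_elem_dvd_mult_iff)
  thus ?thesis
  proof cases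
    case 1
    hence "degree f \<le> 2" using dvd_imp_degree_le[OF 1 g0] g(1) by simp
    thus ?thesis using ge[OF f0 f(2)] by simp
  next
    case 2
    \<comment> \<open>Cancelling f would leave the nonzero constant c as a multiple of the quadratic
      g, which is impossible by degrees.\<close>
    then obtain h where "q = f * h" by (auto elim: dvdE)
    hence "f * [:c:] = f * (g * h)" using eq by (simp add: mult_ac)
    hence "[:c:] = g * h" using f0 by (simp only: mult_cancel_left) simp
    moreover from this have "h \<noteq> 0" using c0 by auto
    ultimately have "degree [:c:] = degree g + degree h" using g0 by (simp add: degree_mult_eq)
    thus ?thesis using g(1) by simp
  qed
qed

section \<open>Heights along a unit orbit\<close>

lemma real_mult_int_sub_int_nonzero:
  fixes \<alpha> :: real and q r :: int
  assumes "\<alpha> \<notin> \<rat>" "q \<noteq> 0"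
  shows "real_of_int q * \<alpha> - real_of_int r \<noteq> 0"
proof
  assume "real_of_int q * \<alpha> - real_of_int r = 0"
  hence "\<alpha> = real_of_int r / real_of_int q" using assms(2) by (simp add: field_simps)
  thus False using assms(1) by simp
qed

text \<open>The two sides differ by - 2 y Q times the quadratic polynomial at \<alpha>. The lemma
  applies to both roots, the conjugate one with - \<delta> in place of \<delta>.\<close>

lemma qpow_orbit_embedding:
  fixes a b c x y Q R :: int and \<alpha> \<delta> :: real
  assumes root: "a * \<alpha>\<^sup>2 + b * \<alpha> + c = 0" and \<delta>: "\<delta> = 2 * a * \<alpha> + b"
  shows "real_of_int (x * Q - y * (b * Q + 2 * a * R)) * \<alpha> - real_of_int (x * R + y * (2 * c * Q + b * R))
     = (real_of_int x + real_of_int y * \<delta>) * (real_of_int Q * \<alpha> - real_of_int R)"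
proof -
  have "real_of_int (x * Q - y * (b * Q + 2 * a * R)) * \<alpha> - real_of_int (x * R + y * (2 * c * Q + b * R))
     - (real_of_int x + real_of_int y * \<delta>) * (real_of_int Q * \<alpha> - real_of_int R)
     = - 2 * y * Q * (a * \<alpha>\<^sup>2 + b * \<alpha> + c)"
    by (simp add: \<delta> power2_eq_square algebra_simps)
  thus ?thesis using root by simp
qed

text \<open>As \<alpha> and \<alpha>' differ, the two forms determine Q and R linearly, which bounds
  the height from above; the growing form L' \<mu>^n bounds it from below.\<close>

lemma height_bounds_of_embeddings:
  fixes \<alpha> \<alpha>' L L' \<mu> :: real
  assumes "\<alpha> \<noteq> \<alpha>'" and L': "L' \<noteq> 0" and \<mu>: "\<mu> > 1"
  obtains C c where "C \<ge> 1" "c > 0"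
    "\<And>(n::nat) (Q::int) (R::int). real_of_int Q * \<alpha> - real_of_int R = L / \<mu> ^ n \<Longrightarrow>
       real_of_int Q * \<alpha>' - real_of_int R = L' * \<mu> ^ n \<Longrightarrow>
       c * \<mu> ^ n \<le> real_of_int (max \<bar>Q\<bar> \<bar>R\<bar>) \<and> real_of_int (max \<bar>Q\<bar> \<bar>R\<bar>) \<le> C * \<mu> ^ n"
proof -
  \<comment> \<open>\<open>A\<close> bounds |Q| / \<mu>^n, and A |\<alpha>| + |L| bounds |R| /
    \<mu>^n; \<open>C\<close> dominates both.\<close>
  define A where "A = (\<bar>L\<bar> + \<bar>L'\<bar>) / \<bar>\<alpha> - \<alpha>'\<bar>"
  define C where "C = max 1 (A * (1 + \<bar>\<alpha>\<bar>) + \<bar>L\<bar>)"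
  define c where "c = \<bar>L'\<bar> / (1 + \<bar>\<alpha>'\<bar>)"
  have A0: "A \<ge> 0" by (simp add: A_def)
  have "c * \<mu> ^ n \<le> real_of_int (max \<bar>Q\<bar> \<bar>R\<bar>) \<and> real_of_int (max \<bar>Q\<bar> \<bar>R\<bar>) \<le> C * \<mu> ^ n"
    if e1: "real_of_int Q * \<alpha> - real_of_int R = L / \<mu> ^ n"
      and e2: "real_of_int Q * \<alpha>' - real_of_int R = L' * \<mu> ^ n" for n :: nat and Q R :: int
  proof -
    define H where "H = real_of_int (max \<bar>Q\<bar> \<bar>R\<bar>)"
    have H: "\<bar>real_of_int Q\<bar> \<le> H" "\<bar>real_of_int R\<bar> \<le> H" by (auto simp: H_def)
    have mn: "\<mu> ^ n \<ge> 1" using \<mu> by (simp add: one_le_power)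
    have "\<bar>L / \<mu> ^ n\<bar> \<le> \<bar>L\<bar>" using mn by (simp add: abs_divide divide_le_eq mult_left_le mult_le_cancel_left1)
    moreover have "\<bar>L\<bar> \<le> \<bar>L\<bar> * \<mu> ^ n" using mn by (simp add: mult_le_cancel_left1)
    ultimately have Ln: "\<bar>L / \<mu> ^ n\<bar> \<le> \<bar>L\<bar> * \<mu> ^ n" by simp
    have "\<bar>L'\<bar> * \<mu> ^ n = \<bar>real_of_int Q * \<alpha>' - real_of_int R\<bar>"
      using mn by (simp add: e2 abs_mult)
    also have "\<dots> \<le> \<bar>real_of_int Q\<bar> * \<bar>\<alpha>'\<bar> + \<bar>real_of_int R\<bar>"
      using abs_triangle_ineq4[of "real_of_int Q * \<alpha>'" "real_of_int R"] by (simp add: abs_mult)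
    also have "\<dots> \<le> H * \<bar>\<alpha>'\<bar> + H" using H by (intro add_mono mult_right_mono) auto
    also have "\<dots> = H * (1 + \<bar>\<alpha>'\<bar>)" by (simp add: algebra_simps)
    finally have low: "c * \<mu> ^ n \<le> H" by (simp add: c_def pos_divide_le_eq field_simps)
    have "real_of_int Q * (\<alpha> - \<alpha>') = L / \<mu> ^ n - L' * \<mu> ^ n"
      using e1 e2 by (simp add: algebra_simps)
    hence "\<bar>real_of_int Q\<bar> * \<bar>\<alpha> - \<alpha>'\<bar> = \<bar>L / \<mu> ^ n - L' * \<mu> ^ n\<bar>" by (metis abs_mult)
    also have "\<dots> \<le> \<bar>L\<bar> * \<mu> ^ n + \<bar>L'\<bar> * \<mu> ^ n"
      using abs_triangle_ineq4[of "L / \<mu> ^ n" "L' * \<mu> ^ n"] Ln mn by (simp add: abs_mult)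
    finally have Q: "\<bar>real_of_int Q\<bar> \<le> A * \<mu> ^ n"
      using assms(1) by (simp add: A_def field_simps)
    have "\<bar>real_of_int R\<bar> = \<bar>real_of_int Q * \<alpha> - L / \<mu> ^ n\<bar>" using e1 by (simp add: algebra_simps)
    also have "\<dots> \<le> \<bar>real_of_int Q\<bar> * \<bar>\<alpha>\<bar> + \<bar>L\<bar> * \<mu> ^ n"
      using abs_triangle_ineq4[of "real_of_int Q * \<alpha>" "L / \<mu> ^ n"] Ln by (simp add: abs_mult)
    also have "\<dots> \<le> A * \<mu> ^ n * \<bar>\<alpha>\<bar> + \<bar>L\<bar> * \<mu> ^ n" using Q mn by (intro add_mono mult_right_mono) auto
    finally have R: "\<bar>real_of_int R\<bar> \<le> (A * \<bar>\<alpha>\<bar> + \<bar>L\<bar>) * \<mu> ^ n" by (simp add: algebra_simps)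
    have "A * \<bar>\<alpha>\<bar> \<ge> 0" using A0 by simp
    hence "A \<le> C" "A * \<bar>\<alpha>\<bar> + \<bar>L\<bar> \<le> C"
      using A0 by (auto simp: C_def le_max_iff_disj distrib_left)
    hence "A * \<mu> ^ n \<le> C * \<mu> ^ n" "(A * \<bar>\<alpha>\<bar> + \<bar>L\<bar>) * \<mu> ^ n \<le> C * \<mu> ^ n"
      using mn by (auto intro!: mult_right_mono)
    hence "H \<le> C * \<mu> ^ n" using Q R by (simp add: H_def)
    thus ?thesis using low by (simp add: H_def)
  qed
  moreover have "c > 0" using L' by (simp add: c_def)
  moreover have "C \<ge> 1" by (simp add: C_def)
  ultimately show ?thesis using that by blast
qed

text \<open>The height is at most C \<mu>^n and the real form is |L| / \<mu>^n, so the powers of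
  \<mu> cancel. The logarithm is at most n E, and the factor n is paid for by \<nu>.\<close>

lemma log_height_product_bounded:
  fixes \<alpha> \<alpha>' L L' \<mu> K :: real and \<nu> :: "int \<Rightarrow> int \<Rightarrow> real"
  assumes \<alpha>: "\<alpha> \<noteq> \<alpha>'" "\<alpha> \<noteq> 0" and L: "L \<noteq> 0" "L' \<noteq> 0" and \<mu>: "\<mu> > 1"
    and \<nu>: "\<And>Q R. \<nu> Q R \<ge> 0"
    and orbit: "\<And>k. \<exists>n\<ge>k. \<exists>Q R. real_of_int Q * \<alpha> - real_of_int R = L / \<mu> ^ n \<and>
       real_of_int Q * \<alpha>' - real_of_int R = L' * \<mu> ^ n \<and> real n * \<nu> Q R \<le> K"
  shows "\<exists>M. \<forall>H. \<exists>Q R. Q * R \<noteq> 0 \<and> max \<bar>Q\<bar> \<bar>R\<bar> \<ge> H \<and>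
    real_of_int (max \<bar>Q\<bar> \<bar>R\<bar>) * ln (real_of_int (max \<bar>Q\<bar> \<bar>R\<bar>)) * \<bar>real_of_int Q * \<alpha> - real_of_int R\<bar> * \<nu> Q R \<le> M"
proof -
  obtain C c where C: "C \<ge> 1" and c: "c > 0" and
    bounds: "\<And>(n::nat) (Q::int) (R::int). real_of_int Q * \<alpha> - real_of_int R = L / \<mu> ^ n \<Longrightarrow>
       real_of_int Q * \<alpha>' - real_of_int R = L' * \<mu> ^ n \<Longrightarrow>
       c * \<mu> ^ n \<le> real_of_int (max \<bar>Q\<bar> \<bar>R\<bar>) \<and> real_of_int (max \<bar>Q\<bar> \<bar>R\<bar>) \<le> C * \<mu> ^ n"
    using height_bounds_of_embeddings[OF \<alpha>(1) L(2) \<mu>] by metis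
  define E where "E = ln C + ln \<mu>"
  have E0: "E \<ge> 0" using C \<mu> by (simp add: E_def)
  define M where "M = C * \<bar>L\<bar> * E * K"
  have "\<exists>Q R. Q * R \<noteq> 0 \<and> max \<bar>Q\<bar> \<bar>R\<bar> \<ge> H \<and>
    real_of_int (max \<bar>Q\<bar> \<bar>R\<bar>) * ln (real_of_int (max \<bar>Q\<bar> \<bar>R\<bar>)) * \<bar>real_of_int Q * \<alpha> - real_of_int R\<bar> * \<nu> Q R \<le> M"
    for H
  proof -
    \<comment> \<open>The three summands, once exceeded by \<mu>^n, force height at least H, Q
      nonzero and R nonzero respectively.\<close>
    define T where "T = \<bar>real_of_int H\<bar> / c + \<bar>L\<bar> + \<bar>L\<bar> / \<bar>\<alpha>\<bar>"
    obtain k0 where k0: "T < \<mu> ^ k0" using real_arch_pow[OF \<mu>] by blast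
    \<comment> \<open>Asking for \<open>Suc k0\<close> makes n positive, which later permits
      replacing ln C by n ln C.\<close>
    obtain n Q R where n: "n \<ge> Suc k0" and e1: "real_of_int Q * \<alpha> - real_of_int R = L / \<mu> ^ n"
      and e2: "real_of_int Q * \<alpha>' - real_of_int R = L' * \<mu> ^ n" and nK: "real n * \<nu> Q R \<le> K"
      using orbit[of "Suc k0"] by blast
    define h where "h = max \<bar>Q\<bar> \<bar>R\<bar>"
    have "\<mu> ^ k0 \<le> \<mu> ^ n" using n \<mu> by (intro power_increasing) auto
    hence T: "T < \<mu> ^ n" using k0 by simp
    have mn: "\<mu> ^ n > 0" using \<mu> by simp
    have parts: "\<bar>real_of_int H\<bar> / c \<ge> 0" "\<bar>L\<bar> / \<bar>\<alpha>\<bar> \<ge> 0" using c by auto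
    have T1: "\<bar>real_of_int H\<bar> / c < \<mu> ^ n" and T2: "\<bar>L\<bar> < \<mu> ^ n" and T3: "\<bar>L\<bar> / \<bar>\<alpha>\<bar> < \<mu> ^ n"
      using T parts unfolding T_def by linarith+
    have hb: "c * \<mu> ^ n \<le> real_of_int h" "real_of_int h \<le> C * \<mu> ^ n"
      using bounds[OF e1 e2] by (auto simp: h_def)
    have "\<bar>real_of_int H\<bar> < c * \<mu> ^ n" using T1 c by (simp add: field_simps)
    hence Hh: "H \<le> h" using hb(1) by linarith
    have ne: "L / \<mu> ^ n \<noteq> 0" using L \<mu> by simp
    have Q0: "Q \<noteq> 0"
    proof
      assume "Q = 0"
      hence "\<bar>real_of_int R\<bar> = \<bar>L\<bar> / \<mu> ^ n" using e1 mn by (metis abs_divide abs_minus_cancel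
          abs_of_pos diff_0 mult_zero_left of_int_0)
      also have "\<dots> < 1" using T2 mn by simp
      finally have "R = 0" by linarith
      thus False using \<open>Q = 0\<close> e1 ne by simp
    qed
    have R0: "R \<noteq> 0"
    proof
      assume R: "R = 0"
      hence "\<bar>real_of_int Q\<bar> * \<bar>\<alpha>\<bar> = \<bar>L\<bar> / \<mu> ^ n" using e1 mn
        by (metis abs_divide abs_mult abs_of_pos diff_zero of_int_0)
      also have "\<dots> < \<bar>\<alpha>\<bar>" using T3 mn \<alpha>(2) by (simp add: field_simps)
      finally have "\<bar>real_of_int Q\<bar> < 1" using \<alpha>(2) by simp
      hence "Q = 0" by linarith
      thus False using Q0 by simp
    qed
    have h1: "h \<ge> 1" using Q0 by (simp add: h_def)
    have "ln (real_of_int h) \<le> ln (C * \<mu> ^ n)" using hb(2) h1 C mn by (subst ln_le_cancel_iff) auto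
    also have "\<dots> = ln C + real n * ln \<mu>" using C \<mu> by (simp add: ln_mult ln_realpow)
    also have "\<dots> \<le> real n * ln C + real n * ln \<mu>"
      using n C by (intro add_right_mono) (simp add: mult_le_cancel_right1)
    also have "\<dots> = real n * E" by (simp add: E_def algebra_simps)
    finally have lnh: "ln (real_of_int h) \<le> real n * E" .
    have e3: "\<bar>real_of_int Q * \<alpha> - real_of_int R\<bar> = \<bar>L\<bar> / \<mu> ^ n"
      unfolding e1 using \<mu> by (simp add: abs_divide)
    have "real_of_int h * ln (real_of_int h) * \<bar>real_of_int Q * \<alpha> - real_of_int R\<bar> * \<nu> Q R
        \<le> (C * \<mu> ^ n) * (real n * E) * (\<bar>L\<bar> / \<mu> ^ n) * \<nu> Q R"
      unfolding e3 using hb(2) lnh h1 \<nu> C mn by (intro mult_right_mono mult_mono) auto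
    also have "(C * \<mu> ^ n) * (real n * E) * (\<bar>L\<bar> / \<mu> ^ n) * \<nu> Q R = C * \<bar>L\<bar> * E * (real n * \<nu> Q R)"
      using \<mu> by simp
    also have "\<dots> \<le> M" unfolding M_def using nK C E0 by (intro mult_left_mono) auto
    finally show ?thesis using Q0 R0 Hh unfolding h_def by (metis mult_eq_0_iff)
  qed
  thus ?thesis by blast
qed

section \<open>From bounded products to the infimum and the lower limit\<close>

text \<open>Dividing the bounded product by the unbounded logarithm of the height makes the values
  in the infimum arbitrarily small.\<close>

lemma INF_zero_and_Liminf_finite:
  fixes \<alpha> M :: real and \<nu> :: "int \<Rightarrow> int \<Rightarrow> real"
  assumes \<nu>: "\<And>Q R. \<nu> Q R \<ge> 0"
    and M: "\<And>H. \<exists>Q R. Q * R \<noteq> 0 \<and> max \<bar>Q\<bar> \<bar>R\<bar> \<ge> H \<and>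
    real_of_int (max \<bar>Q\<bar> \<bar>R\<bar>) * ln (real_of_int (max \<bar>Q\<bar> \<bar>R\<bar>)) * \<bar>real_of_int Q * \<alpha> - real_of_int R\<bar> * \<nu> Q R \<le> M"
  shows "(INF (q, r) \<in> {(q :: int, r :: int). q * r \<noteq> 0}.
            real_of_int (max \<bar>q\<bar> \<bar>r\<bar>) * \<bar>real_of_int q * \<alpha> - real_of_int r\<bar> * \<nu> q r) = 0"
    (is "Inf ?S = 0")
    and "Liminf (filtercomap (\<lambda>(Q :: int, R :: int). max \<bar>Q\<bar> \<bar>R\<bar>) at_top)
           (\<lambda>(Q, R). ereal (real_of_int (max \<bar>Q\<bar> \<bar>R\<bar>) * ln (real_of_int (max \<bar>Q\<bar> \<bar>R\<bar>))
              * \<bar>real_of_int Q * \<alpha> - real_of_int R\<bar> * \<nu> Q R)) < \<infinity>"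
proof -
  show "Inf ?S = 0"
  proof (rule cInf_eq)
    show "0 \<le> v" if "v \<in> ?S" for v using that \<nu> by auto
    fix l assume l: "\<And>v. v \<in> ?S \<Longrightarrow> l \<le> v"
    show "l \<le> 0"
    proof (rule ccontr)
      assume "\<not> l \<le> 0"
      hence l0: "l > 0" by simp
      \<comment> \<open>Beyond this height the logarithm is at least (|M| + 1) / l, so a lower bound
        l > 0 would push the product above M.\<close>
      define H where "H = \<lceil>exp ((\<bar>M\<bar> + 1) / l)\<rceil>"
      obtain Q R where QR: "Q * R \<noteq> 0" "max \<bar>Q\<bar> \<bar>R\<bar> \<ge> H"
        and le: "real_of_int (max \<bar>Q\<bar> \<bar>R\<bar>) * ln (real_of_int (max \<bar>Q\<bar> \<bar>R\<bar>)) * \<bar>real_of_int Q * \<alpha> - real_of_int R\<bar> * \<nu> Q R \<le> M"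
        using M by blast
      define h where "h = real_of_int (max \<bar>Q\<bar> \<bar>R\<bar>)"
      define v where "v = h * \<bar>real_of_int Q * \<alpha> - real_of_int R\<bar> * \<nu> Q R"
      have "exp ((\<bar>M\<bar> + 1) / l) \<le> h" using QR(2) unfolding H_def h_def by linarith
      hence lnh: "(\<bar>M\<bar> + 1) / l \<le> ln h" by (simp add: ln_ge_iff less_le_trans[OF exp_gt_zero])
      have "l \<le> v" using QR(1) unfolding v_def h_def by (intro l) (auto intro!: image_eqI[of _ _ "(Q, R)"])
      hence "(\<bar>M\<bar> + 1) / l * l \<le> ln h * v"
        using lnh l0 by (intro mult_mono) (auto intro: order_trans[rotated, OF lnh])
      also have "\<dots> \<le> M" using le by (simp add: v_def h_def mult_ac)
      finally show False using l0 by simp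
    qed
  qed
next
  let ?F = "filtercomap (\<lambda>(Q :: int, R :: int). max \<bar>Q\<bar> \<bar>R\<bar>) at_top"
  have "Liminf ?F (\<lambda>(Q, R). ereal (real_of_int (max \<bar>Q\<bar> \<bar>R\<bar>) * ln (real_of_int (max \<bar>Q\<bar> \<bar>R\<bar>))
              * \<bar>real_of_int Q * \<alpha> - real_of_int R\<bar> * \<nu> Q R)) \<le> ereal M"
  proof (rule Liminf_least)
    fix P assume "eventually P ?F"
    \<comment> \<open>An eventually true P holds for all pairs of large height, hence for one whose
      value is at most M.\<close>
    then obtain P' where P': "eventually P' at_top" "\<And>Q R. P' (max \<bar>Q\<bar> \<bar>R\<bar>) \<Longrightarrow> P (Q, R)"
      by (auto simp: eventually_filtercomap)
    then obtain H :: int where H: "\<And>h. h \<ge> H \<Longrightarrow> P' h" by (auto simp: eventually_at_top_linorder)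
    obtain Q R where QR: "max \<bar>Q\<bar> \<bar>R\<bar> \<ge> H" and
      le: "real_of_int (max \<bar>Q\<bar> \<bar>R\<bar>) * ln (real_of_int (max \<bar>Q\<bar> \<bar>R\<bar>)) * \<bar>real_of_int Q * \<alpha> - real_of_int R\<bar> * \<nu> Q R \<le> M"
      using M by blast
    have "P (Q, R)" using P'(2) H QR by blast
    thus "(INF x\<in>Collect P. case x of (Q, R) \<Rightarrow> ereal (real_of_int (max \<bar>Q\<bar> \<bar>R\<bar>) * ln (real_of_int (max \<bar>Q\<bar> \<bar>R\<bar>))
              * \<bar>real_of_int Q * \<alpha> - real_of_int R\<bar> * \<nu> Q R)) \<le> ereal M"
      using le by (intro INF_lower2[of "(Q, R)"]) auto
  qed
  thus "Liminf ?F (\<lambda>(Q, R). ereal (real_of_int (max \<bar>Q\<bar> \<bar>R\<bar>) * ln (real_of_int (max \<bar>Q\<bar> \<bar>R\<bar>))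
              * \<bar>real_of_int Q * \<alpha> - real_of_int R\<bar> * \<nu> Q R)) < \<infinity>" by (rule order_le_less_trans) simp
qed

section \<open>Assembly for the given polynomial and p-adic number\<close>

theorem theorem1p2:
  fixes p :: nat and \<alpha> :: real and f :: "int poly" and \<beta> :: "(nat \<Rightarrow> rat) set"
  assumes "prime p"
    and "real_quadratic \<alpha>"
    and "irreducible f"
    and "poly (map_poly real_of_int f) \<alpha> = 0"
    and "\<beta> \<in> carrier (Qp p)"
    and "Qp_eval p f \<beta> \<noteq> \<zero>\<^bsub>Qp p\<^esub>"
  shows "(INF (q, r) \<in> {(q :: int, r :: int). q * r \<noteq> 0}.
            real_of_int (max \<bar>q\<bar> \<bar>r\<bar>) * \<bar>real_of_int q * \<alpha> - real_of_int r\<bar>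
            * Qp_norm p ([q] \<cdot>\<^bsub>Qp p\<^esub> \<beta> \<ominus>\<^bsub>Qp p\<^esub> [r] \<cdot>\<^bsub>Qp p\<^esub> \<one>\<^bsub>Qp p\<^esub>)) = 0
       \<and> Liminf (filtercomap (\<lambda>(Q :: int, R :: int). max \<bar>Q\<bar> \<bar>R\<bar>) at_top)
           (\<lambda>(Q, R). ereal (
              real_of_int (max \<bar>Q\<bar> \<bar>R\<bar>) * ln (real_of_int (max \<bar>Q\<bar> \<bar>R\<bar>))
              * \<bar>real_of_int Q * \<alpha> - real_of_int R\<bar>
              * Qp_norm p ([Q] \<cdot>\<^bsub>Qp p\<^esub> \<beta> \<ominus>\<^bsub>Qp p\<^esub> [R] \<cdot>\<^bsub>Qp p\<^esub> \<one>\<^bsub>Qp p\<^esub>))) < \<infinity>"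
proof -
  note p = \<open>prime p\<close>
  have deg: "degree f = 2" by (rule irreducible_degree_real_quadratic[OF assms(2-4)])
  have irr: "\<alpha> \<notin> \<rat>" by (rule real_quadratic_irrational[OF assms(2)])
  define a b c where "a = coeff f 2" and "b = coeff f 1" and "c = coeff f 0"
  have a0: "a \<noteq> 0" using deg leading_coeff_0_iff[of f] by (auto simp: a_def)
  have root: "a * \<alpha>\<^sup>2 + b * \<alpha> + c = 0"
    using assms(4) deg
    by (simp add: poly_altdef coeff_map_poly degree_map_poly numeral_2_eq_2 a_def b_def c_def)
  obtain s where s: "padic_Cauchy p s" and \<beta>: "\<beta> = padic_null p +>\<^bsub>padic_Cauchy_ring p\<^esub> s"
    using Qp_carrierE[OF p assms(5)] .
  have sum: "(\<Sum>i\<le>degree f. of_int (coeff f i) * t ^ i) = of_int a * t ^ 2 + of_int b * t + of_int c"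
    for t :: rat
    unfolding deg by (simp add: numeral_2_eq_2 a_def b_def c_def)
  have "Qp_eval p f \<beta> = padic_null p +>\<^bsub>padic_Cauchy_ring p\<^esub>
      (\<lambda>m. of_int a * s m ^ 2 + of_int b * s m + of_int c)"
    unfolding \<beta> Qp_eval_coset[OF p s] sum ..
  hence nz: "(\<lambda>m. of_int a * s m ^ 2 + of_int b * s m + of_int c) \<notin> padic_null p"
    using assms(6) Qp_coset_eq_zero[OF p] by metis

  define d where "d = b\<^sup>2 - 4 * a * c"
  define \<delta> where "\<delta> = 2 * a * \<alpha> + b"
  have "\<delta>\<^sup>2 - d = 4 * a * (a * \<alpha>\<^sup>2 + b * \<alpha> + c)"
    by (simp add: \<delta>_def d_def power2_eq_square algebra_simps)
  hence \<delta>2: "\<delta>\<^sup>2 = real_of_int d" using root by simp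
  have \<delta>_irr: "\<delta> \<notin> \<rat>"
  proof
    assume "\<delta> \<in> \<rat>"
    hence "(\<delta> - b) / (2 * a) \<in> \<rat>" by (intro Rats_divide Rats_diff Rats_mult) auto
    thus False using irr a0 by (simp add: \<delta>_def)
  qed
  have \<delta>0: "\<delta> \<noteq> 0" using \<delta>_irr by auto
  \<comment> \<open>The modulus p^2 is the one under which valuations of unit powers were
    computed.\<close>
  have "int p ^ 2 \<noteq> 0" using prime_gt_0_nat[OF p] by simp
  from pell_unit_near_one[OF \<delta>2 \<delta>_irr this] obtain x y where
    x: "int p ^ 2 dvd x - 1" and y: "int p ^ 2 dvd y" "y \<noteq> 0"
    and \<mu>1: "real_of_int x - real_of_int y * \<delta> > 1"
    and inv: "real_of_int x + real_of_int y * \<delta> = 1 / (real_of_int x - real_of_int y * \<delta>)" by metis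
  define \<mu> where "\<mu> = real_of_int x - real_of_int y * \<delta>"
  define \<nu> where "\<nu> Q R = Qp_norm p ([Q] \<cdot>\<^bsub>Qp p\<^esub> \<beta> \<ominus>\<^bsub>Qp p\<^esub> [R] \<cdot>\<^bsub>Qp p\<^esub> \<one>\<^bsub>Qp p\<^esub>)" for Q R :: int
  have \<nu>: "\<nu> Q R = Qp_norm p (padic_null p +>\<^bsub>padic_Cauchy_ring p\<^esub> (\<lambda>m. of_int Q * s m - of_int R))" for Q R
    by (simp add: \<nu>_def \<beta> Qp_linear_form[OF p s])
  have \<nu>0: "\<nu> Q R \<ge> 0" for Q R
  proof -
    have "padic_Cauchy p (\<lambda>m. of_int Q * s m - of_int R)"
      using padic_Cauchy_add[OF p padic_Cauchy_mult[OF p padic_Cauchy_const[OF p, of "of_int Q"] s]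
          padic_Cauchy_const[OF p, of "- of_int R"]] by simp
    thus ?thesis unfolding \<nu> by (rule Qp_norm_nonneg[OF p])
  qed

  have "int p ^ 2 dvd fst (x, y) - 1" "int p ^ 2 dvd snd (x, y)" "snd (x, y) \<noteq> 0" using x y by auto
  then obtain Q\<^sub>0 R\<^sub>0 K where Q0: "Q\<^sub>0 \<noteq> 0" and
    approx: "\<And>k. \<exists>n\<ge>k. real n * \<nu> (fst (qpow d (x, y) n) * Q\<^sub>0 - snd (qpow d (x, y) n) * (b * Q\<^sub>0 + 2 * a * R\<^sub>0))
        (fst (qpow d (x, y) n) * R\<^sub>0 + snd (qpow d (x, y) n) * (2 * c * Q\<^sub>0 + b * R\<^sub>0)) \<le> K"
    using padic_approximations_in_orbit[OF p s nz, of "(x, y)" d, folded \<nu>] by blast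

  \<comment> \<open>The conjugate root, obtained from the sum - b / a of the roots.\<close>
  define \<alpha>' where "\<alpha>' = - b / a - \<alpha>"
  have \<delta>': "- \<delta> = 2 * a * \<alpha>' + b" using a0 by (simp add: \<alpha>'_def \<delta>_def field_simps)
  have "a * \<alpha>'\<^sup>2 + b * \<alpha>' + c = a * \<alpha>\<^sup>2 + b * \<alpha> + c"
    using a0 by (simp add: \<alpha>'_def power2_eq_square field_simps)
  hence root': "a * \<alpha>'\<^sup>2 + b * \<alpha>' + c = 0" using root by simp
  have irr': "\<alpha>' \<notin> \<rat>"
  proof
    assume "\<alpha>' \<in> \<rat>"
    hence "- b / a - \<alpha>' \<in> \<rat>" by (intro Rats_divide Rats_diff) auto
    thus False using irr by (simp add: \<alpha>'_def)
  qed
  have neq: "\<alpha> \<noteq> \<alpha>'"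
  proof
    assume "\<alpha> = \<alpha>'"
    hence "- \<delta> = \<delta>" using \<delta>' by (simp add: \<delta>_def)
    thus False using \<delta>0 by simp
  qed
  \<comment> \<open>L and L' are the two embeddings of the starting vector; the unit contracts the
    first by 1 / \<mu> and expands the second by \<mu>.\<close>
  define L where "L = real_of_int Q\<^sub>0 * \<alpha> - real_of_int R\<^sub>0"
  define L' where "L' = real_of_int Q\<^sub>0 * \<alpha>' - real_of_int R\<^sub>0"
  have L: "L \<noteq> 0" "L' \<noteq> 0"
    unfolding L_def L'_def using real_mult_int_sub_int_nonzero irr irr' Q0 by blast+
  have \<delta>'2: "(- \<delta>)\<^sup>2 = real_of_int d" using \<delta>2 by simp
  have emb: "real_of_int (fst (qpow d (x, y) n)) + real_of_int (snd (qpow d (x, y) n)) * \<delta> = 1 / \<mu> ^ n"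
    "real_of_int (fst (qpow d (x, y) n)) + real_of_int (snd (qpow d (x, y) n)) * (- \<delta>) = \<mu> ^ n" for n
    using qpow_real[OF \<delta>2, of "(x, y)" n] qpow_real[OF \<delta>'2, of "(x, y)" n] inv
    by (auto simp: \<mu>_def power_one_over)
  have orbit: "\<exists>n\<ge>k. \<exists>Q R. real_of_int Q * \<alpha> - real_of_int R = L / \<mu> ^ n \<and>
       real_of_int Q * \<alpha>' - real_of_int R = L' * \<mu> ^ n \<and> real n * \<nu> Q R \<le> K" for k
  proof -
    obtain n where n: "n \<ge> k" "real n * \<nu> (fst (qpow d (x, y) n) * Q\<^sub>0 - snd (qpow d (x, y) n) * (b * Q\<^sub>0 + 2 * a * R\<^sub>0))
        (fst (qpow d (x, y) n) * R\<^sub>0 + snd (qpow d (x, y) n) * (2 * c * Q\<^sub>0 + b * R\<^sub>0)) \<le> K"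
      using approx by blast
    let ?X = "fst (qpow d (x, y) n)" and ?Y = "snd (qpow d (x, y) n)"
    have "real_of_int (?X * Q\<^sub>0 - ?Y * (b * Q\<^sub>0 + 2 * a * R\<^sub>0)) * \<alpha>
        - real_of_int (?X * R\<^sub>0 + ?Y * (2 * c * Q\<^sub>0 + b * R\<^sub>0)) = L / \<mu> ^ n"
      unfolding qpow_orbit_embedding[OF root \<delta>_def] emb L_def by simp
    moreover have "real_of_int (?X * Q\<^sub>0 - ?Y * (b * Q\<^sub>0 + 2 * a * R\<^sub>0)) * \<alpha>'
        - real_of_int (?X * R\<^sub>0 + ?Y * (2 * c * Q\<^sub>0 + b * R\<^sub>0)) = L' * \<mu> ^ n"
      unfolding qpow_orbit_embedding[OF root' \<delta>'] emb L'_def by (rule mult.commute)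
    ultimately show ?thesis using n by blast
  qed
  have \<alpha>0: "\<alpha> \<noteq> 0" using irr by auto
  obtain M where M: "\<And>H. \<exists>Q R. Q * R \<noteq> 0 \<and> max \<bar>Q\<bar> \<bar>R\<bar> \<ge> H \<and>
    real_of_int (max \<bar>Q\<bar> \<bar>R\<bar>) * ln (real_of_int (max \<bar>Q\<bar> \<bar>R\<bar>)) * \<bar>real_of_int Q * \<alpha> - real_of_int R\<bar> * \<nu> Q R \<le> M"
    using log_height_product_bounded[OF neq \<alpha>0 L \<mu>1[folded \<mu>_def] \<nu>0 orbit] by blast
  show ?thesis
    using INF_zero_and_Liminf_finite[OF \<nu>0 M] unfolding \<nu>_def by blast
qed

end
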